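(* Let $1<p\le 2$, $\lambda>0$, $\delta\in(0,1)$, and let $B_R\subset\mathbb{R}^N$ be the open ball of radius $R>0$ centred at the origin. Let $f,g$ be continuous radial functions in $B_R$ such that $0\le f\le g$ in $B_R$ and $f\not\equiv g$ in $B_R$. Assume that $u,v\in C^{1,\alpha}(\overline{B_R})$ (for some $\alpha\in(0,1)$) are radially decreasing solutions of $$-\Delta_p u-\frac{\lambda}{u^\delta}=f(x)\ \text{ in } B_R,\qquad -\Delta_p v-\frac{\lambda}{v^\delta}=g(x)\ \text{ in } B_R,\qquad u=v=0\ \text{ on }\partial B_R .$$ Then $0<u<v$ in $B_R$ and $\frac{\partial v}{\partial\nu}<\frac{\partial u}{\partial\nu}<0$ on $\partial B_R$.
   Context: $\Delta_p u=\mathrm{div}(|\nabla u|^{p-2}\nabla u)$ is the $p$-Laplacian. Solutions are understood in the weak sense and are positive in $B_R$. A function is radial if it depends only on $|x|$; it is radially decreasing if it is radial and decreasing as a function of $r=|x|$. $\nu$ denotes the outward unit normal vector on $\partial B_R$. *)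

theory Defs
  imports "HOL-Analysis.Analysis"
begin

definition gradient :: "('a::euclidean_space \<Rightarrow> real) \<Rightarrow> 'a \<Rightarrow> 'a" where
  "gradient u x = (THE D. GDERIV u x :> D)"

lemma gradient_eqI:
  fixes u :: "'a::euclidean_space \<Rightarrow> real"
  assumes "GDERIV u x :> D"
  shows "gradient u x = D"
  unfolding gradient_def
proof (rule the_equality[of "\<lambda>E. GDERIV u x :> E", OF assms])
  fix E assume "GDERIV u x :> E"
  then have "(\<lambda>h. h \<bullet> E) = (\<lambda>h. h \<bullet> D)"
    using assms has_derivative_unique unfolding gderiv_def by blast
  then have "E \<bullet> h = D \<bullet> h" for h
    by (metis inner_commute)
  then show "E = D"
    by (metis vector_eq_rdot)
qed

definition holder_on :: "real \<Rightarrow> 'a::metric_space set \<Rightarrow> ('a \<Rightarrow> 'b::metric_space) \<Rightarrow> bool" where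
  "holder_on \<alpha> S G \<longleftrightarrow> (\<exists>C. \<forall>x\<in>S. \<forall>y\<in>S. dist (G x) (G y) \<le> C * dist x y powr \<alpha>)"

text \<open>
  For a bounded open set \<open>\<Omega>\<close>, membership in \<open>C\<^sup>1\<^sup>,\<^sup>\<alpha>\<close> of the closure of \<open>\<Omega>\<close>: the gradient,
  which is taken in \<open>\<Omega>\<close> only, has a Hoelder continuous extension \<open>G\<close> to the closure. Values
  of \<open>u\<close> outside the closure are irrelevant.
\<close>

definition C1_holder_closure :: "real \<Rightarrow> 'a::euclidean_space set \<Rightarrow> ('a \<Rightarrow> real) \<Rightarrow> bool" where
  "C1_holder_closure \<alpha> \<Omega> u \<longleftrightarrow>
     continuous_on (closure \<Omega>) u \<and>
     (\<exists>G. (\<forall>x\<in>\<Omega>. GDERIV u x :> G x) \<and> holder_on \<alpha> (closure \<Omega>) G)"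

definition radial_on :: "'a::real_normed_vector set \<Rightarrow> ('a \<Rightarrow> 'b) \<Rightarrow> bool" where
  "radial_on S u \<longleftrightarrow> (\<forall>x\<in>S. \<forall>y\<in>S. norm x = norm y \<longrightarrow> u x = u y)"

definition radially_decreasing_on :: "'a::real_normed_vector set \<Rightarrow> ('a \<Rightarrow> real) \<Rightarrow> bool" where
  "radially_decreasing_on S u \<longleftrightarrow>
     radial_on S u \<and> (\<forall>x\<in>S. \<forall>y\<in>S. norm x \<le> norm y \<longrightarrow> u y \<le> u x)"

primrec C_k :: "nat \<Rightarrow> ('a::euclidean_space \<Rightarrow> real) \<Rightarrow> bool" where
  "C_k 0 \<phi> \<longleftrightarrow> continuous_on UNIV \<phi>"
| "C_k (Suc k) \<phi> \<longleftrightarrow>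
     (\<forall>x. \<phi> differentiable (at x)) \<and>
     (\<forall>b\<in>Basis. C_k k (\<lambda>x. frechet_derivative \<phi> (at x) b))"

text \<open>The space \<open>C\<^sub>c\<^sup>\<infinity>(\<Omega>)\<close>, its elements being extended by zero to the whole space.\<close>

definition test_function :: "'a::euclidean_space set \<Rightarrow> ('a \<Rightarrow> real) \<Rightarrow> bool" where
  "test_function \<Omega> \<phi> \<longleftrightarrow>
     (\<forall>k. C_k k \<phi>) \<and> compact (closure {x. \<phi> x \<noteq> 0}) \<and> closure {x. \<phi> x \<noteq> 0} \<subseteq> \<Omega>"

text \<open>
  The vector \<open>|\<xi>|\<^sup>p\<^sup>-\<^sup>2 \<xi>\<close>. At \<open>\<xi> = 0\<close> it is \<open>0\<close>, which for \<open>1 < p\<close> is its continuous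
  extension, also when \<open>p < 2\<close>.
\<close>

definition p_flux :: "real \<Rightarrow> 'a::real_normed_vector \<Rightarrow> 'a" where
  "p_flux p \<xi> = (norm \<xi> powr (p - 2)) *\<^sub>R \<xi>"

text \<open>
  Positive weak solutions of \<open>- \<Delta>\<^sub>p u - l / u\<^sup>\<delta> = f\<close> in \<open>\<Omega>\<close> with \<open>u = 0\<close> on the boundary, for
  functions \<open>u\<close> that are continuously differentiable in \<open>\<Omega>\<close>, so that the classical gradient
  can be used. If moreover \<open>f\<close> is continuous in \<open>\<Omega>\<close>, all integrands are continuous with
  compact support in \<open>\<Omega>\<close>, hence integrable.
\<close>

definition weak_solution ::
  "real \<Rightarrow> real \<Rightarrow> real \<Rightarrow> 'a::euclidean_space set \<Rightarrow> ('a \<Rightarrow> real) \<Rightarrow> ('a \<Rightarrow> real) \<Rightarrow> bool" where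
  "weak_solution p l \<delta> \<Omega> f u \<longleftrightarrow>
     (\<forall>x\<in>\<Omega>. 0 < u x) \<and>
     (\<forall>x\<in>frontier \<Omega>. u x = 0) \<and>
     (\<forall>\<phi>. test_function \<Omega> \<phi> \<longrightarrow>
        (LINT x:\<Omega>|lborel. p_flux p (gradient u x) \<bullet> gradient \<phi> x)
        - (LINT x:\<Omega>|lborel. l / (u x powr \<delta>) * \<phi> x)
        = (LINT x:\<Omega>|lborel. f x * \<phi> x))"

text \<open>
  The derivative at a boundary point \<open>x\<close> in the direction of the outward unit normal \<open>\<nu>\<close>; it is
  taken from the inner side, where the function is given.
\<close>

definition has_normal_derivative ::
  "('a::real_normed_vector \<Rightarrow> real) \<Rightarrow> 'a \<Rightarrow> 'a \<Rightarrow> real \<Rightarrow> bool" where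
  "has_normal_derivative u \<nu> x d \<longleftrightarrow>
     ((\<lambda>t. u (x + t *\<^sub>R \<nu>)) has_real_derivative d) (at_left 0)"

end

(* In polar coordinates u(x) = U(|x|) and, with Y = - U', the equation integrates to
     r^(N-1) Y^(p-1) = integral_0^r s^(N-1) (l / U^delta + f) ds,
   and likewise for v with profile V and Z = - V'. Put W = V - U and let Phi be the difference
   r^(N-1) (Z^(p-1) - Y^(p-1)) of the fluxes.
   At a negative minimum of W the flux difference vanishes and then increases, so W decreases
   further: hence U <= V. Conversely Phi' >= - C r^(N-1) (R - r)^(-1-delta) W because U(r) is at
   least c (R - r), and W' is controlled by the negative part of Phi because p <= 2. Where
   W = Phi = 0, integrating twice gains the factor (distance)^(1-delta), so W vanishes nearby.
   An interior zero of W would therefore spread to the whole ball and force f = g, and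
   V'(R) = U'(R) would produce interior zeros. *)
theory Submission
  imports Defs "HOL-Computational_Algebra.Polynomial"
begin

section \<open>Smooth bump functions\<close>

text \<open>The term \<open>- l / u^\<delta>\<close> increases with \<open>u\<close>, so the weak
  comparison is a matter of signs. The obstacle is strictness: this term is not Lipschitz near the
  boundary, and for \<open>p < 2\<close> the operator is singular where gradients vanish, so the
  standard linear strong maximum principle and Hopf lemma do not apply as they stand. Moreover
  \<open>C^1\<close> regularity gives a differentiable flux but no second derivative of
  \<open>u\<close>, which is why the argument runs on the first-order pair formed by
  \<open>W\<close> and the flux difference. For \<open>p \<le> 2\<close> the function
  \<open>y^(p-1)\<close> has slope bounded away from 0 on bounded intervals; hence the flux
  difference dominates the slope difference even at critical points. One uniqueness lemma serves the
  centre, interior points and the boundary: interior coefficients are enlarged to the boundary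
  singularity, and a nondecreasing weight absorbs the factor \<open>r^(N-1)\<close>, which
  degenerates at the centre for \<open>N > 1\<close>. The lemma is one-sided: it only bounds
  \<open>W\<close> from above, the bound from below being the weak comparison.\<close>

lemma C_k_SucI:
  fixes f :: "'a::euclidean_space \<Rightarrow> real"
  assumes "\<And>x. (f has_derivative f' x) (at x)"
    and "\<And>b. b \<in> Basis \<Longrightarrow> C_k k (\<lambda>x. f' x b)"
  shows "C_k (Suc k) f"
proof -
  have "frechet_derivative f (at x) = f' x" for x
    using frechet_derivative_at[OF assms(1)] by simp
  then show ?thesis
    using assms by (auto simp: differentiable_def)
qed

lemma C_k_SucE:
  fixes f :: "'a::euclidean_space \<Rightarrow> real"
  assumes "C_k (Suc k) f"
  obtains f' where "\<And>x. (f has_derivative f' x) (at x)"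
    and "\<And>b. b \<in> Basis \<Longrightarrow> C_k k (\<lambda>x. f' x b)"
  using assms that[of "\<lambda>x. frechet_derivative f (at x)"] by (simp add: frechet_derivative_works)

text \<open>Products need this: their derivative keeps one factor undifferentiated, but at the lower
  order.\<close>

lemma C_k_SucD: "C_k (Suc k) f \<Longrightarrow> C_k k f"
proof (induction k arbitrary: f)
  case 0
  then show ?case
    by (simp add: continuous_at_imp_continuous_on differentiable_imp_continuous_within)
qed auto

lemma C_k_const: "C_k k (\<lambda>x. c)"
proof (induction k arbitrary: c)
  case (Suc k)
  then show ?case
    by (intro C_k_SucI[where f' = "\<lambda>x h. 0"]) auto
qed simp

lemma C_k_inner_left: "C_k k (\<lambda>x. x \<bullet> c)"
proof (cases k)
  case (Suc j)
  have "C_k (Suc j) (\<lambda>x. x \<bullet> c)"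
    by (rule C_k_SucI[where f' = "\<lambda>x h. h \<bullet> c"]) (auto intro!: derivative_eq_intros C_k_const)
  with Suc show ?thesis
    by simp
qed (simp add: continuous_intros)

lemma C_k_add:
  assumes "C_k k f" and "C_k k g"
  shows "C_k k (\<lambda>x. f x + g x)"
  using assms
proof (induction k arbitrary: f g)
  case (Suc k)
  obtain f' where f': "\<And>x. (f has_derivative f' x) (at x)" "\<And>b. b \<in> Basis \<Longrightarrow> C_k k (\<lambda>x. f' x b)"
    using C_k_SucE Suc.prems(1) by blast
  obtain g' where g': "\<And>x. (g has_derivative g' x) (at x)" "\<And>b. b \<in> Basis \<Longrightarrow> C_k k (\<lambda>x. g' x b)"
    using C_k_SucE Suc.prems(2) by blast
  show ?case
    by (rule C_k_SucI[where f' = "\<lambda>x h. f' x h + g' x h"])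
      (auto intro!: has_derivative_add f' g' Suc.IH)
qed (simp add: continuous_intros)

lemma C_k_mult:
  assumes "C_k k f" and "C_k k g"
  shows "C_k k (\<lambda>x. f x * g x)"
  using assms
proof (induction k arbitrary: f g)
  case (Suc k)
  obtain f' where f': "\<And>x. (f has_derivative f' x) (at x)" "\<And>b. b \<in> Basis \<Longrightarrow> C_k k (\<lambda>x. f' x b)"
    using C_k_SucE Suc.prems(1) by blast
  obtain g' where g': "\<And>x. (g has_derivative g' x) (at x)" "\<And>b. b \<in> Basis \<Longrightarrow> C_k k (\<lambda>x. g' x b)"
    using C_k_SucE Suc.prems(2) by blast
  show ?case
    by (rule C_k_SucI[where f' = "\<lambda>x h. f x * g' x h + f' x h * g x"])
      (auto intro!: has_derivative_mult f' g' C_k_add Suc.IH C_k_SucD[OF Suc.prems(1)]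
        C_k_SucD[OF Suc.prems(2)])
qed (simp add: continuous_intros)

text \<open>Each partial derivative is \<open>\<rho>' (x \<bullet> x)\<close> times a linear
  function, so such products reproduce themselves and no general chain rule for \<open>C_k\<close>
  is involved. All orders of \<open>\<rho>\<close> are assumed at once so that the induction can
  pass to \<open>\<rho>'\<close>.\<close>

lemma C_k_compose_inner_self:
  fixes \<rho> :: "real \<Rightarrow> real"
  assumes "\<And>k. C_k k \<rho>"
  shows "C_k k (\<lambda>x::'a::euclidean_space. \<rho> (x \<bullet> x))"
  using assms
proof (induction k arbitrary: \<rho>)
  case 0
  have "continuous_on UNIV \<rho>"
    using 0[of 0] by simp
  then show ?case
    by (auto intro!: continuous_on_compose2[of UNIV \<rho>] continuous_intros)
next
  case (Suc k)
  define \<rho>' where "\<rho>' = (\<lambda>t. frechet_derivative \<rho> (at t) 1)"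
  have smooth': "C_k j \<rho>'" for j
    using Suc.prems[of "Suc j"] by (simp add: \<rho>'_def)
  have "\<rho> differentiable (at t)" for t
    using Suc.prems[of "Suc 0"] by simp
  then have *: "(\<rho> has_derivative frechet_derivative \<rho> (at t)) (at t)" for t
    by (simp add: frechet_derivative_works)
  have "frechet_derivative \<rho> (at t) h = \<rho>' t * h" for t h
    using linear_scale[OF has_derivative_linear[OF *[of t]], of h 1] by (simp add: \<rho>'_def mult.commute)
  with * have D: "(\<rho> has_derivative (\<lambda>h. \<rho>' t * h)) (at t)" for t
    by (metis ext)
  show ?case
  proof (rule C_k_SucI[where f' = "\<lambda>x h. \<rho>' (x \<bullet> x) * (2 * (x \<bullet> h))"])
    show "((\<lambda>x. \<rho> (x \<bullet> x)) has_derivative (\<lambda>h. \<rho>' (x \<bullet> x) * (2 * (x \<bullet> h)))) (at x)" for x :: 'a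
    proof -
      have "((\<lambda>x. x \<bullet> x) has_derivative (\<lambda>h. 2 * (x \<bullet> h))) (at x)"
        by (auto intro!: derivative_eq_intros simp: inner_commute)
      from has_derivative_compose[OF this D] show ?thesis .
    qed
    show "C_k k (\<lambda>x. \<rho>' (x \<bullet> x) * (2 * (x \<bullet> b)))" for b :: 'a
      by (intro C_k_mult Suc.IH smooth' C_k_const C_k_inner_left)
  qed
qed

section \<open>Flat functions and one-dimensional bumps\<close>

text \<open>The classical function \<open>exp (- 1 / t)\<close> with a polynomial in
  \<open>s = 1 / t\<close> as a factor. The factor makes the family closed under differentiation:
  \<open>P\<close> becomes \<open>s^2 (P - P')\<close>, so smoothness is an induction with
  \<open>P\<close> arbitrary.\<close>

definition flat_exp :: "real poly \<Rightarrow> real \<Rightarrow> real" where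
  "flat_exp P t = (if 0 < t then poly P (1 / t) * exp (- (1 / t)) else 0)"

lemma flat_exp_tendsto_0: "(flat_exp P \<longlongrightarrow> 0) (at 0)"
proof -
  have "((\<lambda>s. poly P s / exp s) \<longlongrightarrow> 0) at_top"
  proof -
    have "((\<lambda>s. coeff P i * (s ^ i / exp s)) \<longlongrightarrow> coeff P i * 0) at_top" for i
      by (intro tendsto_intros tendsto_power_div_exp_0)
    then have "((\<lambda>s. \<Sum>i\<le>degree P. coeff P i * (s ^ i / exp s)) \<longlongrightarrow> (\<Sum>i\<le>degree P. coeff P i * 0)) at_top"
      by (intro tendsto_sum)
    then show ?thesis
      by (simp add: poly_altdef sum_divide_distrib)
  qed
  then have "((\<lambda>t::real. poly P (inverse t) / exp (inverse t)) \<longlongrightarrow> 0) (at_right 0)"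
    by (rule filterlim_compose[OF _ filterlim_inverse_at_top_right])
  moreover have "eventually (\<lambda>t::real. poly P (inverse t) / exp (inverse t) = flat_exp P t) (at_right 0)"
    by (auto simp: eventually_at_filter flat_exp_def exp_minus field_simps)
  ultimately have R: "(flat_exp P \<longlongrightarrow> 0) (at_right 0)"
    using tendsto_cong by force
  have "eventually (\<lambda>t::real. 0 = flat_exp P t) (at_left 0)"
    by (auto simp: eventually_at_filter flat_exp_def)
  then have L: "(flat_exp P \<longlongrightarrow> 0) (at_left 0)"
    by (rule tendsto_eventually[OF eventually_mono]) auto
  from R L show ?thesis
    by (simp add: filterlim_at_split)
qed

lemma flat_exp_has_derivative:
  "(flat_exp P has_real_derivative flat_exp ([:0, 0, 1:] * (P - pderiv P)) t) (at t)"
proof -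
  consider "t < 0" | "t = 0" | "0 < t" by linarith
  then show ?thesis
  proof cases
    case 1
    have "((\<lambda>t. 0) has_real_derivative flat_exp ([:0, 0, 1:] * (P - pderiv P)) t) (at t)"
      using 1 by (simp add: flat_exp_def)
    then show ?thesis
      by (rule has_field_derivative_transform_within_open[where S = "{..<0}"])
        (use 1 in \<open>auto simp: flat_exp_def\<close>)
  next
    case 2
    \<comment> \<open>At 0 the difference quotient belongs to the same family, with polynomial
      \<open>s P\<close>, so its limit is already known.\<close>
    have "((\<lambda>h. (flat_exp P h - flat_exp P 0) / (h - 0)) \<longlongrightarrow> 0) (at 0)"
    proof -
      have "(flat_exp P h - flat_exp P 0) / (h - 0) = flat_exp ([:0, 1:] * P) h" for h
        by (simp add: flat_exp_def)
      then show ?thesis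
        using flat_exp_tendsto_0 by simp
    qed
    then show ?thesis
      using 2 by (simp add: has_field_derivative_iff flat_exp_def)
  next
    case 3
    have "((\<lambda>t. poly P (1 / t) * exp (- (1 / t))) has_real_derivative
        flat_exp ([:0, 0, 1:] * (P - pderiv P)) t) (at t)"
      using 3 by (auto intro!: derivative_eq_intros DERIV_chain'[OF _ poly_DERIV]
          simp: flat_exp_def field_simps)
    then show ?thesis
      by (rule has_field_derivative_transform_within_open[where S = "{0<..}"])
        (use 3 in \<open>auto simp: flat_exp_def\<close>)
  qed
qed

text \<open>The affine argument covers both factors of the bump, \<open>t - a\<close> and
  \<open>b - t\<close>.\<close>

lemma C_k_flat_exp_affine:
  fixes \<sigma> c :: real
  shows "C_k k (\<lambda>t. flat_exp P (\<sigma> * t + c))"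
proof (induction k arbitrary: P)
  case 0
  have "continuous_on UNIV (flat_exp P)"
    using flat_exp_has_derivative DERIV_isCont continuous_at_imp_continuous_on by blast
  then show ?case
    by (auto intro!: continuous_on_compose2[of UNIV "flat_exp P"] continuous_intros)
next
  case (Suc k)
  let ?Q = "[:0, 0, 1:] * (P - pderiv P)"
  have "((\<lambda>t. flat_exp P (\<sigma> * t + c)) has_derivative
      (\<lambda>h. flat_exp ?Q (\<sigma> * t + c) * \<sigma> * h)) (at t)" for t
    using DERIV_chain2[OF flat_exp_has_derivative DERIV_add[OF DERIV_cmult[OF DERIV_ident] DERIV_const],
        of P \<sigma> c t]
    by (simp add: has_field_derivative_def)
  then show ?case
    by (rule C_k_SucI) (simp add: C_k_mult C_k_const Suc)
qed

definition bump :: "real \<Rightarrow> real \<Rightarrow> real \<Rightarrow> real" where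
  "bump a b t = flat_exp 1 (t - a) * flat_exp 1 (b - t)"

lemma C_k_bump: "C_k k (bump a b)"
  using C_k_mult[OF C_k_flat_exp_affine[of k 1 1 "- a"] C_k_flat_exp_affine[of k 1 "- 1" b]]
  unfolding bump_def by simp

lemma bump_pos: "a < t \<Longrightarrow> t < b \<Longrightarrow> 0 < bump a b t"
  and bump_nonneg: "0 \<le> bump a b t"
  and bump_eq_0: "t \<le> a \<or> b \<le> t \<Longrightarrow> bump a b t = 0"
  by (auto simp: bump_def flat_exp_def)

lemma continuous_on_bump: "continuous_on S (bump a b)"
  using C_k_bump[of 0 a b] by (auto intro: continuous_on_subset)

text \<open>The test function is prescribed through its derivative, because the weak equation sees
  the flux through the gradient of the test function. Normalising the primitive at \<open>b\<close>
  makes it vanish from \<open>b\<close> on.\<close>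

lemma bump_primitive:
  obtains \<rho> where "\<And>t. (\<rho> has_real_derivative - bump a b t) (at t)"
    and "\<And>t. b \<le> t \<Longrightarrow> \<rho> t = 0" and "\<And>k. C_k k \<rho>"
proof -
  obtain B where B: "\<And>t. (B has_vector_derivative bump a b t) (at t)"
    using einterval_antiderivative[of "-\<infinity>" "\<infinity>" "bump a b"] continuous_on_bump[of UNIV a b]
    by (auto simp: continuous_on_eq_continuous_at)
  define \<rho> where "\<rho> t = B b - B t" for t
  have D: "(\<rho> has_real_derivative - bump a b t) (at t)" for t
    unfolding \<rho>_def using B[of t]
    by (auto intro!: derivative_eq_intros simp: has_real_derivative_iff_has_vector_derivative)
  have "\<rho> t = \<rho> b" if "b \<le> t" for t
    using that
  proof (cases "b = t")
    case False
    with that have "b < t" by simp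
    have "\<exists>z>b. z < t \<and> \<rho> t - \<rho> b = (t - b) * (- bump a b z)"
      using MVT2[OF \<open>b < t\<close> D] by simp
    then show ?thesis
      by (auto simp: bump_eq_0)
  qed simp
  moreover have "C_k k \<rho>" for k
  \<comment> \<open>Order \<open>Suc k\<close> is proved instead of \<open>k\<close>: it concerns
    only the derivative \<open>- bump a b\<close>, smooth of every order, and \<open>k = 0\<close>
    needs no separate case.\<close>
  proof (rule C_k_SucD, rule C_k_SucI)
    show "(\<rho> has_derivative (\<lambda>h. - bump a b t * h)) (at t)" for t
      using D[of t] unfolding has_field_derivative_def .
    have "C_k k (\<lambda>x. - 1 * bump a b x * y)" for y
      by (intro C_k_mult C_k_const C_k_bump)
    then show "C_k k (\<lambda>x. - bump a b x * y)" for y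
      by simp
  qed
  ultimately show ?thesis
    using that[of \<rho>] D by (simp add: \<rho>_def)
qed

section \<open>Integrals of radial functions\<close>

text \<open>Polar coordinates for radial integrands, without a surface measure: both measures are
  determined by their finite values on the half-lines \<open>{..a}\<close>. These are the volumes of
  balls, and the density is the derivative of the volume in the radius.\<close>

lemma distr_norm_lborel:
  "distr (lborel :: 'a::euclidean_space measure) borel norm =
    density lborel (\<lambda>r. ennreal (indicator {0..} r *
      (unit_ball_vol DIM('a) * (DIM('a) * r ^ (DIM('a) - 1)))))" (is "?M = ?N")
proof -
  let ?\<kappa> = "unit_ball_vol DIM('a)"
  have *: "emeasure ?M {..a} = emeasure ?N {..a}" "emeasure ?M {..a} < \<infinity>" for a :: real
  proof -
    have M: "emeasure ?M {..a} = emeasure lborel {x :: 'a. norm x \<le> a}"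
      by (subst emeasure_distr) (auto intro!: arg_cong[where f = "emeasure lborel"])
    have N: "emeasure ?N {..a} = (\<integral>\<^sup>+ r. ennreal (?\<kappa> * (DIM('a) * r ^ (DIM('a) - 1)))
        * indicator {0..a} r \<partial>lborel)"
      by (subst emeasure_density)
        (auto intro!: nn_integral_cong split: split_indicator)
    show "emeasure ?M {..a} = emeasure ?N {..a}" "emeasure ?M {..a} < \<infinity>"
    proof (atomize(full), cases "a < 0")
      case True
      then have "{x :: 'a. norm x \<le> a} = {}"
        by (auto dest: order.trans[OF norm_ge_zero])
      with True M N show "emeasure ?M {..a} = emeasure ?N {..a} \<and> emeasure ?M {..a} < \<infinity>"
        by simp
    next
      case False
      then have a: "0 \<le> a"
        by simp
      have "{x :: 'a. norm x \<le> a} = cball 0 a"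
        by auto
      with M a have "emeasure ?M {..a} = ennreal (?\<kappa> * a ^ DIM('a))"
        by (simp add: emeasure_cball)
      moreover have "emeasure ?N {..a} = ennreal (?\<kappa> * a ^ DIM('a) - ?\<kappa> * 0 ^ DIM('a))"
        unfolding N
        by (rule nn_integral_FTC_Icc) (use a in \<open>auto intro!: derivative_eq_intros\<close>)
      ultimately show "emeasure ?M {..a} = emeasure ?N {..a} \<and> emeasure ?M {..a} < \<infinity>"
        by (simp add: zero_power)
    qed
  qed
  have S: "sets borel = sigma_sets (UNIV :: real set) (range atMost)"
    by (subst borel_eq_atMost) simp
  show ?thesis
  proof (rule measure_eqI_generator_eq[where \<Omega> = UNIV and E = "range atMost" and A = "\<lambda>i. {..real i}"])
    show "Int_stable (range (atMost :: real \<Rightarrow> real set))"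
      by (auto simp: Int_stable_def)
    show "(\<Union>i. {..real i}) = UNIV"
      by (auto intro: real_arch_simple)
    show "emeasure ?M X = emeasure ?N X" if "X \<in> range atMost" for X
      using that * by auto
    show "emeasure ?M {..real i} \<noteq> \<infinity>" for i
      using *(2)[of "real i"] by simp
  qed (auto simp: S)
qed

lemma integral_radial:
  fixes F :: "real \<Rightarrow> real"
  assumes "0 \<le> a" and "continuous_on {a..b} F"
  shows "(LINT x|lborel. indicator {a..b} (norm (x :: 'a::euclidean_space)) * F (norm x)) =
    unit_ball_vol DIM('a) * DIM('a) * integral {a..b} (\<lambda>r. r ^ (DIM('a) - 1) * F r)"
proof -
  let ?\<kappa> = "unit_ball_vol DIM('a)" and ?n = "DIM('a) - 1"
  have F: "(\<lambda>r. indicator {a..b} r * F r) \<in> borel_measurable borel"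
    using borel_measurable_continuous_on_indicator[OF _ assms(2)] by simp
  have "(LINT x|lborel. indicator {a..b} (norm (x :: 'a)) * F (norm x)) =
      integral\<^sup>L (distr (lborel :: 'a measure) borel norm) (\<lambda>r. indicator {a..b} r * F r)"
    using F by (subst integral_distr) auto
  also have "\<dots> = (LINT r|lborel. (indicator {0..} r * (?\<kappa> * (DIM('a) * r ^ ?n))) *\<^sub>R
      (indicator {a..b} r * F r))"
    unfolding distr_norm_lborel using F
    by (subst integral_density) (auto split: split_indicator)
  also have "\<dots> = (LINT r:{a..b}|lborel. (?\<kappa> * DIM('a)) * (r ^ ?n * F r))"
    unfolding set_lebesgue_integral_def using assms(1)
    by (intro Bochner_Integration.integral_cong) (auto split: split_indicator)
  also have "\<dots> = (?\<kappa> * DIM('a)) * (LINT r:{a..b}|lborel. r ^ ?n * F r)"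
    by simp
  also have "(LINT r:{a..b}|lborel. r ^ ?n * F r) = integral {a..b} (\<lambda>r. r ^ ?n * F r)"
    by (intro set_borel_integral_eq_integral borel_integrable_atLeastAtMost')
      (intro continuous_intros assms)
  finally show ?thesis .
qed

section \<open>Uniqueness for a singular differential inequality\<close>

text \<open>
  The singular factor \<open>(t - a)\<^sup>-\<^sup>1\<^sup>-\<^sup>\<delta>\<close> loses one power to the linear bound on \<open>W\<close> and is then
  integrable because \<open>\<delta> < 1\<close>, so a linear bound \<open>m (t - a)\<close> on a short interval improves to
  \<open>m / 2 (t - a)\<close>.
\<close>

lemma degenerate_uniqueness_step:
  fixes W \<Phi> W' \<Phi>' \<omega> \<omega>' :: "real \<Rightarrow> real"
  assumes "\<delta> < 1" and "0 \<le> C" and "0 \<le> L" and "0 \<le> m"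
    and \<epsilon>: "L * C * (b - a) powr (1 - \<delta>) \<le> (1 - \<delta>) / 2"
    and cont: "continuous_on {a..b} W" "continuous_on {a..b} \<Phi>" "continuous_on {a..b} \<omega>"
    and init: "W a = 0" "\<Phi> a = 0"
    and W: "\<And>t. a < t \<Longrightarrow> t < b \<Longrightarrow> (W has_real_derivative W' t) (at t)"
    and \<Phi>: "\<And>t. a < t \<Longrightarrow> t < b \<Longrightarrow> (\<Phi> has_real_derivative \<Phi>' t) (at t)"
    and \<omega>: "\<And>t. a < t \<Longrightarrow> t < b \<Longrightarrow> (\<omega> has_real_derivative \<omega>' t) (at t)"
    and \<omega>': "\<And>t. a < t \<Longrightarrow> t < b \<Longrightarrow> 0 \<le> \<omega>' t"
    and \<omega>_pos: "\<And>t. a < t \<Longrightarrow> t < b \<Longrightarrow> 0 < \<omega> t"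
    and \<Phi>': "\<And>t. a < t \<Longrightarrow> t < b \<Longrightarrow> - (C * \<omega> t * (t - a) powr (- 1 - \<delta>) * W t) \<le> \<Phi>' t"
    and W': "\<And>t. a < t \<Longrightarrow> t < b \<Longrightarrow> W' t * \<omega> t \<le> L * max 0 (- \<Phi> t)"
    and bound: "\<And>t. a \<le> t \<Longrightarrow> t \<le> b \<Longrightarrow> W t \<le> m * (t - a)"
    and t: "a \<le> t" "t \<le> b"
  shows "W t \<le> m / 2 * (t - a)"
proof -
  have \<Phi>_ge: "- (C * m * \<omega> s * (s - a) powr (1 - \<delta>) / (1 - \<delta>)) \<le> \<Phi> s" if s: "a < s" "s < b" for s
  proof -
    \<comment> \<open>The added term is an antiderivative barrier: inserting
      \<open>W r \<le> m (r - a)\<close> into the bound for \<open>\<Phi>'\<close> leaves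
      \<open>(r - a)^(- \<delta>)\<close>, which the derivative of
      \<open>(r - a)^(1 - \<delta>)\<close> balances exactly. The remaining term contains
      \<open>\<omega>' \<ge> 0\<close> and has the good sign.\<close>
    define H where "H r = \<Phi> r + C * m / (1 - \<delta>) * (\<omega> r * (r - a) powr (1 - \<delta>))" for r
    have "H a \<le> H s"
    proof (rule DERIV_nonneg_imp_increasing_open[where f = H])
      show "a \<le> s" using s by simp
      have *: "{a..s} \<subseteq> {a..b}" using s by auto
      show "continuous_on {a..s} H"
        unfolding H_def using \<open>\<delta> < 1\<close>
        by (intro continuous_on_powr' continuous_intros cont[THEN continuous_on_subset[OF _ *]]) auto
      show "\<exists>y. (H has_real_derivative y) (at r) \<and> 0 \<le> y" if r: "a < r" "r < s" for r
      proof (intro exI conjI)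
        have rb: "r < b" using r s by simp
        have "((\<lambda>r. (r - a) powr (1 - \<delta>)) has_real_derivative (1 - \<delta>) * (r - a) powr (- \<delta>)) (at r)"
          using r by (auto intro!: derivative_eq_intros)
        from DERIV_add[OF \<Phi>[OF r(1) rb] DERIV_cmult[OF DERIV_mult[OF \<omega>[OF r(1) rb] this]]]
        show "(H has_real_derivative \<Phi>' r + C * m / (1 - \<delta>) *
            (\<omega>' r * (r - a) powr (1 - \<delta>) + (1 - \<delta>) * (r - a) powr (- \<delta>) * \<omega> r)) (at r)"
          unfolding H_def .
        have p2: "(r - a) powr (- 1 - \<delta>) * (r - a) = (r - a) powr (- \<delta>)"
          using r powr_add[of "r - a" "- 1 - \<delta>" 1] by simp
        have "C * \<omega> r * (r - a) powr (- 1 - \<delta>) * W r \<le>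
            C * \<omega> r * (r - a) powr (- 1 - \<delta>) * (m * (r - a))"
          using bound[of r] r rb \<omega>_pos[OF r(1) rb] \<open>0 \<le> C\<close> by (intro mult_left_mono) auto
        also have "\<dots> = C * m / (1 - \<delta>) * ((1 - \<delta>) * (r - a) powr (- \<delta>) * \<omega> r)"
          using \<open>\<delta> < 1\<close> by (simp flip: p2)
        finally have "- (C * m / (1 - \<delta>) * ((1 - \<delta>) * (r - a) powr (- \<delta>) * \<omega> r)) \<le> \<Phi>' r"
          using \<Phi>'[OF r(1) rb] by linarith
        moreover have "0 \<le> C * m / (1 - \<delta>) * (\<omega>' r * (r - a) powr (1 - \<delta>))"
          using assms(1,2,4) \<omega>'[OF r(1) rb] by simp
        ultimately show "0 \<le> \<Phi>' r + C * m / (1 - \<delta>) *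
            (\<omega>' r * (r - a) powr (1 - \<delta>) + (1 - \<delta>) * (r - a) powr (- \<delta>) * \<omega> r)"
          unfolding distrib_left by linarith
      qed
    qed
    then show ?thesis
      by (simp add: H_def init)
  qed
  have W'_le: "W' s \<le> m / 2" if s: "a < s" "s < b" for s
  proof -
    have "max 0 (- \<Phi> s) \<le> C * m * \<omega> s * (s - a) powr (1 - \<delta>) / (1 - \<delta>)"
      using \<Phi>_ge[OF s] \<omega>_pos[OF s] assms(1,2,4) by simp
    also have "\<dots> \<le> C * m * \<omega> s * (b - a) powr (1 - \<delta>) / (1 - \<delta>)"
      using s \<omega>_pos[OF s] assms(1,2,4)
      by (intro divide_right_mono mult_left_mono powr_mono2) auto
    finally have "L * max 0 (- \<Phi> s) \<le> L * (C * m * \<omega> s * (b - a) powr (1 - \<delta>) / (1 - \<delta>))"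
      using assms(3) by (rule mult_left_mono)
    also have "\<dots> = (L * C * (b - a) powr (1 - \<delta>)) * (m * \<omega> s / (1 - \<delta>))"
      by simp
    also have "\<dots> \<le> (1 - \<delta>) / 2 * (m * \<omega> s / (1 - \<delta>))"
      using \<omega>_pos[OF s] assms(1,4) by (intro mult_right_mono \<epsilon>) simp
    also have "\<dots> = m / 2 * \<omega> s"
      using assms(1) by (simp add: field_simps)
    \<comment> \<open>The weight occurs on both sides and cancels at every \<open>s > a\<close>, so
      \<open>\<omega> a = 0\<close> is allowed, as for \<open>r ^ n\<close> at the origin.\<close>
    finally have "W' s * \<omega> s \<le> m / 2 * \<omega> s"
      using W'[OF s] by linarith
    then show ?thesis
      using \<omega>_pos[OF s] by (rule mult_right_le_imp_le)
  qed
  have "m / 2 * (a - a) - W a \<le> m / 2 * (t - a) - W t"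
  proof (rule DERIV_nonneg_imp_increasing_open[OF t(1), where f = "\<lambda>t. m / 2 * (t - a) - W t"])
    have *: "{a..t} \<subseteq> {a..b}" using t by auto
    show "continuous_on {a..t} (\<lambda>t. m / 2 * (t - a) - W t)"
      by (intro continuous_intros cont[THEN continuous_on_subset[OF _ *]])
    show "\<exists>y. ((\<lambda>t. m / 2 * (t - a) - W t) has_real_derivative y) (at s) \<and> 0 \<le> y"
      if "a < s" "s < t" for s
      using that t W[of s] W'_le[of s]
      by (intro exI[of _ "m / 2 - W' s"]) (auto intro!: derivative_eq_intros)
  qed
  then show ?thesis
    using init by simp
qed

text \<open>The length of the interval in the halving step does not depend on \<open>m\<close>. The
  step can thus be iterated on one fixed interval, giving
  \<open>W t \<le> m / 2 ^ k * (t - a)\<close> for all \<open>k\<close>; the bound \<open>B\<close>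
  on \<open>W'\<close> provides the first \<open>m\<close>, and \<open>W \<ge> 0\<close>
  finishes.\<close>

lemma degenerate_uniqueness:
  fixes W \<Phi> W' \<Phi>' \<omega> \<omega>' :: "real \<Rightarrow> real"
  assumes "a < b" and "\<delta> < 1" and "0 \<le> C" and "0 \<le> L"
    and cont: "continuous_on {a..b} W" "continuous_on {a..b} \<Phi>" "continuous_on {a..b} \<omega>"
    and init: "W a = 0" "\<Phi> a = 0"
    and W_nonneg: "\<And>t. a \<le> t \<Longrightarrow> t \<le> b \<Longrightarrow> 0 \<le> W t"
    and W: "\<And>t. a < t \<Longrightarrow> t < b \<Longrightarrow> (W has_real_derivative W' t) (at t)"
    and \<Phi>: "\<And>t. a < t \<Longrightarrow> t < b \<Longrightarrow> (\<Phi> has_real_derivative \<Phi>' t) (at t)"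
    and \<omega>: "\<And>t. a < t \<Longrightarrow> t < b \<Longrightarrow> (\<omega> has_real_derivative \<omega>' t) (at t)"
    and \<omega>': "\<And>t. a < t \<Longrightarrow> t < b \<Longrightarrow> 0 \<le> \<omega>' t"
    and \<omega>_pos: "\<And>t. a < t \<Longrightarrow> t < b \<Longrightarrow> 0 < \<omega> t"
    and \<Phi>': "\<And>t. a < t \<Longrightarrow> t < b \<Longrightarrow> - (C * \<omega> t * (t - a) powr (- 1 - \<delta>) * W t) \<le> \<Phi>' t"
    and W': "\<And>t. a < t \<Longrightarrow> t < b \<Longrightarrow> W' t * \<omega> t \<le> L * max 0 (- \<Phi> t)"
    and W'_bound: "\<And>t. a < t \<Longrightarrow> t < b \<Longrightarrow> W' t \<le> B"
  obtains \<epsilon> where "0 < \<epsilon>" and "\<epsilon> \<le> b - a" and "\<And>t. a \<le> t \<Longrightarrow> t \<le> a + \<epsilon> \<Longrightarrow> W t = 0"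
proof -
  \<comment> \<open>Chosen so that \<open>L * C * \<eta> \<le> (1 - \<delta>) / 2\<close>, the
    smallness the halving step asks for; the \<open>+ 1\<close> keeps the denominator positive when
    \<open>L * C = 0\<close>. Then \<open>\<epsilon>\<close> solves
    \<open>\<epsilon> powr (1 - \<delta>) = \<eta>\<close>, unless the interval is shorter.\<close>
  define \<eta> where "\<eta> = (1 - \<delta>) / (2 * (L * C + 1))"
  define \<epsilon> where "\<epsilon> = min (b - a) (\<eta> powr (1 / (1 - \<delta>)))"
  have \<eta>: "0 < \<eta>"
    using assms by (simp add: \<eta>_def add_nonneg_pos)
  then have "0 < \<epsilon>"
    using \<open>a < b\<close> by (simp add: \<epsilon>_def)
  have "\<epsilon> powr (1 - \<delta>) \<le> (\<eta> powr (1 / (1 - \<delta>))) powr (1 - \<delta>)"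
    using \<open>0 < \<epsilon>\<close> \<open>\<delta> < 1\<close> by (intro powr_mono2) (auto simp: \<epsilon>_def)
  also have "\<dots> = \<eta>"
    using \<eta> \<open>\<delta> < 1\<close> by (simp add: powr_powr)
  finally have "L * C * \<epsilon> powr (1 - \<delta>) \<le> L * C * \<eta>"
    using assms by (intro mult_left_mono) auto
  also have "\<dots> \<le> (L * C + 1) * \<eta>"
    using \<eta> by simp
  also have "\<dots> = (1 - \<delta>) / 2"
  proof -
    have *: "x * ((1 - \<delta>) / (2 * x)) = (1 - \<delta>) / 2" if "0 < x" for x :: real
      using that by simp
    show ?thesis
      unfolding \<eta>_def by (rule *) (use assms in \<open>simp add: add_nonneg_pos\<close>)
  qed
  finally have \<epsilon>: "L * C * (a + \<epsilon> - a) powr (1 - \<delta>) \<le> (1 - \<delta>) / 2"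
    by simp
  have le_b: "a + \<epsilon> \<le> b"
    by (simp add: \<epsilon>_def)
  then have sub: "{a..a + \<epsilon>} \<subseteq> {a..b}"
    by auto
  note cont' = cont[THEN continuous_on_subset[OF _ sub]]
  define m where "m = max B 0"
  have W_le: "W t \<le> m / 2 ^ k * (t - a)" if "a \<le> t" "t \<le> a + \<epsilon>" for t k
    using that
  proof (induction k arbitrary: t)
    case 0
    have "m * (a - a) - W a \<le> m * (t - a) - W t"
    proof (rule DERIV_nonneg_imp_increasing_open[OF 0(1), where f = "\<lambda>t. m * (t - a) - W t"])
      have *: "{a..t} \<subseteq> {a..b}" using 0 le_b by auto
      show "continuous_on {a..t} (\<lambda>t. m * (t - a) - W t)"
        by (intro continuous_intros cont[THEN continuous_on_subset[OF _ *]])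
      show "\<exists>y. ((\<lambda>t. m * (t - a) - W t) has_real_derivative y) (at s) \<and> 0 \<le> y"
        if "a < s" "s < t" for s
        using that 0 le_b W[of s] W'_bound[of s]
        by (intro exI[of _ "m - W' s"]) (auto intro!: derivative_eq_intros simp: m_def)
    qed
    then show ?case
      using init by simp
  next
    case (Suc k)
    have "W t \<le> (m / 2 ^ k) / 2 * (t - a)"
      by (rule degenerate_uniqueness_step[OF assms(2-4) _ \<epsilon> cont' init W \<Phi> \<omega> \<omega>' \<omega>_pos \<Phi>' W' Suc.IH Suc.prems])
        (use le_b in \<open>auto simp: m_def\<close>)
    then show ?case
      by simp
  qed
  show ?thesis
  proof (rule that[OF \<open>0 < \<epsilon>\<close>])
    show "\<epsilon> \<le> b - a" using le_b by simp
    show "W t = 0" if t: "a \<le> t" "t \<le> a + \<epsilon>" for t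
    proof -
      have "(\<lambda>k. m * (t - a) * (1 / 2) ^ k) \<longlonglongrightarrow> m * (t - a) * 0"
        by (intro tendsto_intros LIMSEQ_power_zero) simp
      then have "W t \<le> m * (t - a) * 0"
        by (rule LIMSEQ_le_const) (use W_le[OF t] in \<open>auto simp: power_one_over field_simps\<close>)
      then show ?thesis
        using W_nonneg[of t] t le_b by simp
    qed
  qed
qed

section \<open>Radial profiles\<close>

text \<open>The restriction \<open>p \<le> 2\<close> enters only through this bound.\<close>

lemma powr_diff_ge:
  fixes y z M :: real
  assumes "1 < p" "p \<le> 2" "0 \<le> z" "z \<le> y" "y \<le> M" "0 < M"
  shows "y - z \<le> M powr (2 - p) / (p - 1) * (y powr (p - 1) - z powr (p - 1))"
proof (cases "z = y")
  case False
  then have "z < y" using assms by simp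
  \<comment> \<open>At \<open>z\<close> only continuity is used: \<open>z = 0\<close> is allowed,
    and there the power has infinite slope when \<open>p < 2\<close>.\<close>
  have "continuous_on {z..y} (\<lambda>t. t powr (p - 1))"
    using assms by (intro continuous_on_powr' continuous_intros) auto
  moreover have "((\<lambda>t. t powr (p - 1)) has_derivative (\<lambda>h. (p - 1) * t powr (p - 2) * h)) (at t)"
    if "z < t" "t < y" for t
  proof -
    have "((\<lambda>t. t powr (p - 1)) has_real_derivative (p - 1) * t powr (p - 1 - 1)) (at t)"
      using that assms by (intro has_real_derivative_powr) auto
    then show ?thesis
      by (simp add: has_field_derivative_def)
  qed
  ultimately obtain \<xi> where \<xi>: "z < \<xi>" "\<xi> < y"
    and eq: "y powr (p - 1) - z powr (p - 1) = (p - 1) * \<xi> powr (p - 2) * (y - z)"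
    using mvt[OF \<open>z < y\<close>, of "\<lambda>t. t powr (p - 1)" "\<lambda>t h. (p - 1) * t powr (p - 2) * h"] by blast
  \<comment> \<open>Since \<open>p - 2 \<le> 0\<close> and \<open>\<xi> \<le> M\<close>, the factor
    \<open>\<xi> powr (p - 2)\<close> is at least \<open>M powr (p - 2)\<close>.\<close>
  have "1 = M powr (2 - p) * M powr (p - 2)"
    using \<open>0 < M\<close> by (simp flip: powr_add)
  also have "\<dots> \<le> M powr (2 - p) * \<xi> powr (p - 2)"
    using \<xi> assms by (intro mult_left_mono powr_mono2') auto
  finally have "1 * (y - z) \<le> M powr (2 - p) * \<xi> powr (p - 2) * (y - z)"
    using \<open>z < y\<close> by (intro mult_right_mono) auto
  also have "\<dots> = M powr (2 - p) / (p - 1) * (y powr (p - 1) - z powr (p - 1))"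
    unfolding eq using assms by simp
  finally show ?thesis
    by simp
qed simp

text \<open>By the mean value theorem, with the slope estimated at the smaller point, where it is
  steepest. This is the source of the singular exponent \<open>- 1 - \<delta>\<close>.\<close>

lemma inverse_powr_diff_le:
  fixes x y \<delta> :: real
  assumes "0 < \<delta>" "0 < x" "x \<le> y"
  shows "1 / x powr \<delta> - 1 / y powr \<delta> \<le> \<delta> * x powr (- 1 - \<delta>) * (y - x)"
proof (cases "x = y")
  case False
  then have "x < y" using assms by simp
  have D: "((\<lambda>t. t powr (- \<delta>)) has_real_derivative (- \<delta>) * t powr (- \<delta> - 1)) (at t)"
    if "x \<le> t" for t
    using that assms by (intro has_real_derivative_powr) auto
  obtain \<xi> where \<xi>: "x < \<xi>" "\<xi> < y"
    and eq: "y powr (- \<delta>) - x powr (- \<delta>) = (y - x) * ((- \<delta>) * \<xi> powr (- \<delta> - 1))"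
    using MVT2[OF \<open>x < y\<close> D] by blast
  have "1 / x powr \<delta> - 1 / y powr \<delta> = \<delta> * \<xi> powr (- \<delta> - 1) * (y - x)"
    using eq by (simp add: powr_minus_divide algebra_simps)
  also have "\<dots> \<le> \<delta> * x powr (- \<delta> - 1) * (y - x)"
    using \<xi> assms by (intro mult_right_mono mult_left_mono powr_mono2') auto
  also have "- \<delta> - 1 = - 1 - \<delta>"
    by simp
  finally show ?thesis .
qed simp

text \<open>What remains of a radial solution along one ray, with \<open>n = N - 1\<close>. The
  slope \<open>Y = - U'\<close> is a separate datum because the equation differentiates the flux and
  not \<open>Y\<close> itself; its continuity up to \<open>R\<close> carries the boundary
  derivative.\<close>

locale radial_profile =
  fixes p l \<delta> R :: real and n :: nat and h U Y :: "real \<Rightarrow> real"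
  assumes p: "1 < p" "p \<le> 2" and l: "0 < l" and \<delta>: "0 < \<delta>" "\<delta> < 1" and R: "0 < R"
    and h: "continuous_on {0..<R} h" "\<And>r. 0 \<le> r \<Longrightarrow> r < R \<Longrightarrow> 0 \<le> h r"
    and U: "continuous_on {0..R} U" "\<And>r. 0 \<le> r \<Longrightarrow> r < R \<Longrightarrow> 0 < U r" "U R = 0"
    and U_deriv: "\<And>r. 0 < r \<Longrightarrow> r < R \<Longrightarrow> (U has_real_derivative - Y r) (at r)"
    and Y: "continuous_on {0..R} Y" "Y 0 = 0" "\<And>r. 0 \<le> r \<Longrightarrow> r \<le> R \<Longrightarrow> 0 \<le> Y r"
    and flux_deriv: "\<And>r. 0 < r \<Longrightarrow> r < R \<Longrightarrow>
      ((\<lambda>r. r ^ n * Y r powr (p - 1)) has_real_derivative r ^ n * (l / U r powr \<delta> + h r)) (at r)"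
begin

lemma flux: "continuous_on {0..R} (\<lambda>r. r ^ n * Y r powr (p - 1))"
  using p Y by (intro continuous_on_powr' continuous_intros) auto

lemma Y_pos:
  assumes "0 < r" "r \<le> R"
  shows "0 < Y r"
proof -
  \<comment> \<open>For \<open>n = 0\<close> the factor \<open>0 ^ n\<close> is 1, so it is
    \<open>Y 0 = 0\<close> that makes the flux start from 0.\<close>
  have "0 ^ n * Y 0 powr (p - 1) < r ^ n * Y r powr (p - 1)"
  proof (rule DERIV_pos_imp_increasing_open[OF assms(1), where f = "\<lambda>r. r ^ n * Y r powr (p - 1)"])
    show "continuous_on {0..r} (\<lambda>r. r ^ n * Y r powr (p - 1))"
      by (rule continuous_on_subset[OF flux]) (use assms in auto)
    show "\<exists>y. ((\<lambda>r. r ^ n * Y r powr (p - 1)) has_real_derivative y) (at s) \<and> 0 < y"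
      if "0 < s" "s < r" for s
      using flux_deriv[of s] that assms h(2)[of s] U(2)[of s] l
      by (intro exI[of _ "s ^ n * (l / U s powr \<delta> + h s)"]) (auto intro!: mult_pos_pos add_pos_nonneg)
  qed
  then have "Y r \<noteq> 0"
    using Y(2) by auto
  with Y(3)[of r] assms show ?thesis
    by simp
qed

lemma U_antimono:
  assumes "0 \<le> r" "r \<le> s" "s \<le> R"
  shows "U s \<le> U r"
proof -
  have "- U r \<le> - U s"
  proof (rule DERIV_nonneg_imp_increasing_open[OF assms(2), where f = "\<lambda>r. - U r"])
    show "continuous_on {r..s} (\<lambda>r. - U r)"
      by (intro continuous_intros continuous_on_subset[OF U(1)]) (use assms in auto)
    show "\<exists>y. ((\<lambda>r. - U r) has_real_derivative y) (at t) \<and> 0 \<le> y" if "r < t" "t < s" for t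
      using DERIV_minus[OF U_deriv[of t]] Y(3)[of t] that assms by (intro exI[of _ "Y t"]) auto
  qed
  then show ?thesis by simp
qed

text \<open>On \<open>{R/2..R}\<close> the slope has a positive minimum, and integrating it back
  from \<open>R\<close> gives a linear bound. The slope vanishes at the centre, so on the inner half
  monotonicity is used instead: there \<open>U\<close> is at least \<open>U (R/2)\<close>.\<close>

lemma U_lower_bound:
  obtains c where "0 < c" and "\<And>r. 0 \<le> r \<Longrightarrow> r \<le> R \<Longrightarrow> c * (R - r) \<le> U r"
proof -
  have "continuous_on {R/2..R} Y"
    by (rule continuous_on_subset[OF Y(1)]) (use R in auto)
  then obtain r0 where r0: "r0 \<in> {R/2..R}" "\<And>r. r \<in> {R/2..R} \<Longrightarrow> Y r0 \<le> Y r"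
    using continuous_attains_inf[of "{R/2..R}" Y] R by auto
  have y0: "0 < Y r0"
    using r0(1) R by (intro Y_pos) auto
  have half: "Y r0 * (R - r) \<le> U r" if r: "R/2 \<le> r" "r \<le> R" for r
  proof -
    have "Y r0 * (R - r) - U r \<le> Y r0 * (R - R) - U R"
    proof (rule DERIV_nonneg_imp_increasing_open[OF r(2), where f = "\<lambda>t. Y r0 * (R - t) - U t"])
      show "continuous_on {r..R} (\<lambda>t. Y r0 * (R - t) - U t)"
        by (intro continuous_intros continuous_on_subset[OF U(1)]) (use r R in auto)
      show "\<exists>y. ((\<lambda>t. Y r0 * (R - t) - U t) has_real_derivative y) (at t) \<and> 0 \<le> y"
        if "r < t" "t < R" for t
        using that r R r0(2)[of t] U_deriv[of t]
        by (intro exI[of _ "- Y r0 + Y t"]) (auto intro!: derivative_eq_intros)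
    qed
    then show ?thesis
      using U(3) by simp
  qed
  define c where "c = min (Y r0) (U (R/2) / R)"
  have "0 < c"
    using y0 U(2)[of "R/2"] R by (simp add: c_def)
  moreover have "c * (R - r) \<le> U r" if r: "0 \<le> r" "r \<le> R" for r
  proof (cases "R/2 \<le> r")
    case True
    have "c * (R - r) \<le> Y r0 * (R - r)"
      using r by (intro mult_right_mono) (auto simp: c_def)
    with half[OF True r(2)] show ?thesis by simp
  next
    case False
    have "c * (R - r) \<le> U (R/2) / R * R"
      using r R U(2)[of "R/2"] by (intro mult_mono) (auto simp: c_def)
    also have "\<dots> = U (R/2)"
      using R by simp
    also have "\<dots> \<le> U r"
      using False r R by (intro U_antimono) auto
    finally show ?thesis .
  qed
  ultimately show ?thesis
    using that by blast
qed

text \<open>Differentiability is given only for \<open>r < R\<close>; the one-sided derivative at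
  \<open>R\<close> is the limit of the slopes, by l'Hopital's rule.\<close>

lemma U_boundary_deriv: "(U has_real_derivative - Y R) (at_left R)"
proof -
  have isCont_left: "(U \<longlongrightarrow> U R) (at_left R)"
    using U(1) R by (metis continuous_on_Icc_at_leftD)
  have lim_Y: "(Y \<longlongrightarrow> Y R) (at_left R)"
  proof (rule continuous_on_Icc_at_leftD)
    show "continuous_on {R/2..R} Y"
      by (rule continuous_on_subset[OF Y(1)]) (use R in auto)
  qed (use R in simp)
  have ev: "eventually (\<lambda>r. 0 < r \<and> r < R) (at_left R)"
    using eventually_at_left_real[OF R] by eventually_elim auto
  have "((\<lambda>r. U r / (r - R)) \<longlongrightarrow> - Y R) (at_left R)"
  proof (rule lhopital_left[where f' = "\<lambda>r. - Y r" and g' = "\<lambda>r. 1"])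
    show "(U \<longlongrightarrow> 0) (at_left R)"
      using isCont_left U(3) by simp
    show "((\<lambda>r. r - R) \<longlongrightarrow> 0) (at_left R)"
      by (auto intro!: tendsto_eq_intros)
    show "eventually (\<lambda>r. (U has_real_derivative - Y r) (at r)) (at_left R)"
      using ev by eventually_elim (auto intro: U_deriv)
    show "eventually (\<lambda>r. r - R \<noteq> 0) (at_left R)"
      using ev by eventually_elim auto
    show "((\<lambda>r. - Y r / 1) \<longlongrightarrow> - Y R) (at_left R)"
      using tendsto_minus[OF lim_Y] by simp
  qed (auto intro!: derivative_eq_intros always_eventually)
  then show ?thesis
    using U(3) by (simp add: has_field_derivative_iff)
qed

end

section \<open>Comparison of two profiles\<close>

locale profile_pair =
  u: radial_profile p l \<delta> R n f U Y + v: radial_profile p l \<delta> R n g V Z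
  for p l \<delta> R :: real and n :: nat and f U Y g V Z :: "real \<Rightarrow> real" +
  assumes f_le_g: "\<And>r. 0 \<le> r \<Longrightarrow> r < R \<Longrightarrow> f r \<le> g r"
begin

definition W :: "real \<Rightarrow> real" where
  "W r = V r - U r"

definition \<Phi> :: "real \<Rightarrow> real" where
  "\<Phi> r = r ^ n * Z r powr (p - 1) - r ^ n * Y r powr (p - 1)"

definition \<Phi>' :: "real \<Rightarrow> real" where
  "\<Phi>' r = r ^ n * (g r - f r - l * (1 / U r powr \<delta> - 1 / V r powr \<delta>))"

lemma W_cont: "continuous_on {0..R} W"
  unfolding W_def by (intro continuous_intros u.U(1) v.U(1))

lemma \<Phi>_cont: "continuous_on {0..R} \<Phi>"
  unfolding \<Phi>_def by (intro continuous_intros u.flux v.flux)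

lemma \<Phi>_0: "\<Phi> 0 = 0"
  by (simp add: \<Phi>_def u.Y(2) v.Y(2))

lemma W_R: "W R = 0"
  by (simp add: W_def u.U(3) v.U(3))

lemma W_deriv: "0 < r \<Longrightarrow> r < R \<Longrightarrow> (W has_real_derivative Y r - Z r) (at r)"
  unfolding W_def using DERIV_diff[OF v.U_deriv u.U_deriv, of r] by simp

lemma \<Phi>_deriv: "0 < r \<Longrightarrow> r < R \<Longrightarrow> (\<Phi> has_real_derivative \<Phi>' r) (at r)"
  unfolding \<Phi>_def \<Phi>'_def using DERIV_diff[OF v.flux_deriv u.flux_deriv, of r]
  by (simp add: algebra_simps)

lemma powr_less_iff_Y_Z:
  assumes "0 < r" "r \<le> R"
  shows "Y r powr (p - 1) < Z r powr (p - 1) \<longleftrightarrow> Y r < Z r"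
    and "Y r powr (p - 1) = Z r powr (p - 1) \<longleftrightarrow> Y r = Z r"
proof -
  have mono: "x powr (p - 1) < y powr (p - 1)" if "0 \<le> x" "x < y" for x y
    using that u.p(1) by (intro powr_less_mono2) auto
  show "Y r powr (p - 1) < Z r powr (p - 1) \<longleftrightarrow> Y r < Z r"
    "Y r powr (p - 1) = Z r powr (p - 1) \<longleftrightarrow> Y r = Z r"
    using mono[of "Y r" "Z r"] mono[of "Z r" "Y r"] u.Y(3)[of r] v.Y(3)[of r] assms
    by (cases "Y r" "Z r" rule: linorder_cases; simp)+
qed

lemma \<Phi>_pos_iff: "0 < r \<Longrightarrow> r \<le> R \<Longrightarrow> 0 < \<Phi> r \<longleftrightarrow> Y r < Z r"
  and \<Phi>_eq_0_iff: "0 < r \<Longrightarrow> r \<le> R \<Longrightarrow> \<Phi> r = 0 \<longleftrightarrow> Y r = Z r"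
  using powr_less_iff_Y_Z[of r] by (auto simp: \<Phi>_def)

section \<open>Weak comparison and contact points\<close>

lemma U_le_V:
  assumes "0 \<le> r" "r \<le> R"
  shows "U r \<le> V r"
proof (rule ccontr)
  assume "\<not> U r \<le> V r"
  then have neg: "W r < 0"
    by (simp add: W_def)
  obtain a where a: "a \<in> {0..R}" and min: "\<And>t. t \<in> {0..R} \<Longrightarrow> W a \<le> W t"
    using continuous_attains_inf[OF _ _ W_cont] u.R by auto
  have Wa: "W a < 0"
    using min[of r] neg assms by simp
  then have "a < R"
    using a W_R by (cases "a = R") auto
  \<comment> \<open>An interior minimum has equal slopes. If the minimum sits at the centre, the
    flux difference vanishes there anyway.\<close>
  have \<Phi>a: "\<Phi> a = 0"
  proof (cases "a = 0")
    case False
    then have "0 < a" using a by simp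
    have "Y a - Z a = 0"
    proof (rule DERIV_local_min[OF W_deriv[OF \<open>0 < a\<close> \<open>a < R\<close>]])
      show "0 < min a (R - a)"
        using \<open>0 < a\<close> \<open>a < R\<close> by simp
      show "\<forall>y. \<bar>a - y\<bar> < min a (R - a) \<longrightarrow> W a \<le> W y"
        by (auto intro!: min)
    qed
    then show ?thesis
      using \<Phi>_eq_0_iff[of a] \<open>0 < a\<close> \<open>a < R\<close> by simp
  qed (simp add: \<Phi>_0)
  have "eventually (\<lambda>t. W t < 0) (at_right a)"
  proof (rule order_tendstoD(2)[OF continuous_on_Icc_at_rightD])
    show "continuous_on {a..R} W"
      by (rule continuous_on_subset[OF W_cont]) (use a in auto)
  qed (use \<open>a < R\<close> Wa in auto)
  then obtain b where b: "a < b" "\<And>t. a < t \<Longrightarrow> t < b \<Longrightarrow> W t < 0"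
    unfolding eventually_at_right_field by blast
  define c where "c = min ((a + b) / 2) ((a + R) / 2)"
  have c: "a < c" "c < R" "c < b"
    using b(1) \<open>a < R\<close> by (auto simp: c_def min_less_iff_disj)
  \<comment> \<open>Where \<open>V < U\<close>, the singular term of \<open>V\<close> is strictly
    larger and \<open>g - f \<ge> 0\<close> adds to it.\<close>
  have \<Phi>'_pos: "0 < \<Phi>' t" if t: "a < t" "t \<le> c" for t
  proof -
    have "0 < V t" "V t < U t"
      using b(2)[of t] t c a v.U(2)[of t] by (auto simp: W_def)
    then have "V t powr \<delta> < U t powr \<delta>" "0 < V t powr \<delta>"
      using u.\<delta> by (auto intro!: powr_less_mono2)
    then have "1 / U t powr \<delta> < 1 / V t powr \<delta>"
      by (intro divide_strict_left_mono mult_pos_pos) linarith+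
    then have "0 < l * (1 / V t powr \<delta> - 1 / U t powr \<delta>)"
      using u.l by simp
    then have "0 < g t - f t - l * (1 / U t powr \<delta> - 1 / V t powr \<delta>)"
      using f_le_g[of t] t c a by (simp add: algebra_simps)
    then show ?thesis
      unfolding \<Phi>'_def using t a by simp
  qed
  have \<Phi>_pos: "0 < \<Phi> t" if t: "a < t" "t \<le> c" for t
  proof -
    have "\<Phi> a < \<Phi> t"
    proof (rule DERIV_pos_imp_increasing_open[OF t(1)])
      show "continuous_on {a..t} \<Phi>"
        by (rule continuous_on_subset[OF \<Phi>_cont]) (use a t c in auto)
      show "\<exists>y. (\<Phi> has_real_derivative y) (at s) \<and> 0 < y" if "a < s" "s < t" for s
        using \<Phi>_deriv[of s] \<Phi>'_pos[of s] that t a c by auto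
    qed
    with \<Phi>a show ?thesis by simp
  qed
  have "- W a < - W c"
  proof (rule DERIV_pos_imp_increasing_open[OF c(1), where f = "\<lambda>t. - W t"])
    show "continuous_on {a..c} (\<lambda>t. - W t)"
      by (intro continuous_intros continuous_on_subset[OF W_cont]) (use a c in auto)
    show "\<exists>y. ((\<lambda>t. - W t) has_real_derivative y) (at s) \<and> 0 < y" if "a < s" "s < c" for s
      using DERIV_minus[OF W_deriv[of s]] \<Phi>_pos[of s] \<Phi>_pos_iff[of s] that a c
      by (intro exI[of _ "- (Y s - Z s)"]) auto
  qed
  then show False
    using min[of c] a c by simp
qed

lemma W_nonneg: "0 \<le> r \<Longrightarrow> r \<le> R \<Longrightarrow> 0 \<le> W r"
  using U_le_V[of r] by (simp add: W_def)

text \<open>Once \<open>W \<ge> 0\<close> is known, a zero of \<open>W\<close> is a minimum, so the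
  slopes agree there. At \<open>R\<close> the minimum would be one-sided, which is why
  \<open>r < R\<close>.\<close>

lemma \<Phi>_eq_0:
  assumes "0 \<le> r" "r < R" "W r = 0"
  shows "\<Phi> r = 0"
proof (cases "r = 0")
  case False
  then have "0 < r" using assms by simp
  have "Y r - Z r = 0"
  proof (rule DERIV_local_min[OF W_deriv[OF \<open>0 < r\<close> \<open>r < R\<close>]])
    show "0 < min r (R - r)"
      using \<open>0 < r\<close> \<open>r < R\<close> by simp
    show "\<forall>y. \<bar>r - y\<bar> < min r (R - r) \<longrightarrow> W r \<le> W y"
      unfolding assms(3) by (auto intro!: W_nonneg)
  qed
  then show ?thesis
    using \<Phi>_eq_0_iff[of r] \<open>0 < r\<close> \<open>r < R\<close> by simp
qed (simp add: \<Phi>_0)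

section \<open>One-sided estimates for the pair of differences\<close>

lemma \<Phi>'_lower_bound:
  obtains C where "0 \<le> C"
    and "\<And>r. 0 < r \<Longrightarrow> r < R \<Longrightarrow> - (C * r ^ n * (R - r) powr (- 1 - \<delta>) * W r) \<le> \<Phi>' r"
proof -
  obtain c where c: "0 < c" "\<And>r. 0 \<le> r \<Longrightarrow> r \<le> R \<Longrightarrow> c * (R - r) \<le> U r"
    using u.U_lower_bound by metis
  \<comment> \<open>The factor \<open>l * \<delta>\<close> comes from the mean value bound for the
    singular term, the power of \<open>c\<close> from \<open>U r \<ge> c (R - r)\<close>; the
    contribution \<open>g - f \<ge> 0\<close> is dropped.\<close>
  define C where "C = l * \<delta> * c powr (- 1 - \<delta>)"
  have "- (C * r ^ n * (R - r) powr (- 1 - \<delta>) * W r) \<le> \<Phi>' r" if r: "0 < r" "r < R" for r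
  proof -
    have "1 / U r powr \<delta> - 1 / V r powr \<delta> \<le> \<delta> * U r powr (- 1 - \<delta>) * W r"
      unfolding W_def using r u.U(2) U_le_V[of r] u.\<delta> by (intro inverse_powr_diff_le) auto
    also have "\<dots> \<le> \<delta> * (c * (R - r)) powr (- 1 - \<delta>) * W r"
      using r c u.\<delta> W_nonneg[of r] by (intro mult_right_mono mult_left_mono powr_mono2') auto
    also have "(c * (R - r)) powr (- 1 - \<delta>) = c powr (- 1 - \<delta>) * (R - r) powr (- 1 - \<delta>)"
      using c(1) r by (simp add: powr_mult)
    finally have "l * (1 / U r powr \<delta> - 1 / V r powr \<delta>) \<le>
        l * (\<delta> * (c powr (- 1 - \<delta>) * (R - r) powr (- 1 - \<delta>)) * W r)"
      using u.l by (intro mult_left_mono) auto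
    also have "\<dots> = C * (R - r) powr (- 1 - \<delta>) * W r"
      by (simp add: C_def)
    finally have "- (C * (R - r) powr (- 1 - \<delta>) * W r) \<le>
        g r - f r - l * (1 / U r powr \<delta> - 1 / V r powr \<delta>)"
      using f_le_g[of r] r by simp
    then have "r ^ n * - (C * (R - r) powr (- 1 - \<delta>) * W r) \<le> \<Phi>' r"
      unfolding \<Phi>'_def using r by (intro mult_left_mono) auto
    then show ?thesis
      by (simp add: algebra_simps)
  qed
  moreover have "0 \<le> C"
    using u.l u.\<delta> by (simp add: C_def)
  ultimately show ?thesis
    using that by blast
qed

lemma slope_bound:
  obtains M where "0 < M" and "\<And>r. 0 \<le> r \<Longrightarrow> r \<le> R \<Longrightarrow> Y r \<le> M \<and> Z r \<le> M"
proof -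
  have "continuous_on {0..R} (\<lambda>r. max (Y r) (Z r))"
    by (intro continuous_intros u.Y(1) v.Y(1))
  then obtain a where a: "a \<in> {0..R}" "\<And>r. r \<in> {0..R} \<Longrightarrow> max (Y r) (Z r) \<le> max (Y a) (Z a)"
    using continuous_attains_sup[of "{0..R}" "\<lambda>r. max (Y r) (Z r)"] u.R by auto
  show ?thesis
  proof (rule that[of "max (Y a) (Z a)"])
    show "0 < max (Y a) (Z a)"
      using u.Y_pos[of R] a(2)[of R] u.R by auto
    show "Y r \<le> max (Y a) (Z a) \<and> Z r \<le> max (Y a) (Z a)" if "0 \<le> r" "r \<le> R" for r
      using a(2)[of r] that by auto
  qed
qed

text \<open>Both signs are recorded: propagation to the right needs a bound on
  \<open>W' = Y - Z\<close>, propagation to the left, with the direction reversed, one on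
  \<open>Z - Y\<close>. Taking \<open>max 0\<close> makes each bound trivial where the slope
  difference is negative.\<close>

lemma flux_controls_slope:
  obtains L where "0 \<le> L"
    and "\<And>r. 0 < r \<Longrightarrow> r \<le> R \<Longrightarrow> (Y r - Z r) * r ^ n \<le> L * max 0 (- \<Phi> r)"
    and "\<And>r. 0 < r \<Longrightarrow> r \<le> R \<Longrightarrow> (Z r - Y r) * r ^ n \<le> L * max 0 (\<Phi> r)"
proof -
  obtain M where M: "0 < M" and M_bound: "\<And>r. 0 \<le> r \<Longrightarrow> r \<le> R \<Longrightarrow> Y r \<le> M \<and> Z r \<le> M"
    using slope_bound by metis
  define L where "L = M powr (2 - p) / (p - 1)"
  have L: "0 \<le> L"
    using u.p by (simp add: L_def)
  have key: "(y - z) * r ^ n \<le> L * max 0 (r ^ n * y powr (p - 1) - r ^ n * z powr (p - 1))"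
    if "0 < r" "0 \<le> y" "0 \<le> z" "y \<le> M" for r y z :: real
  proof (cases "z \<le> y")
    case True
    have "(y - z) * r ^ n \<le> L * (y powr (p - 1) - z powr (p - 1)) * r ^ n"
      unfolding L_def using that u.p M True by (intro mult_right_mono powr_diff_ge) auto
    also have "\<dots> = L * (r ^ n * y powr (p - 1) - r ^ n * z powr (p - 1))"
      by (simp add: algebra_simps)
    also have "\<dots> \<le> L * max 0 (r ^ n * y powr (p - 1) - r ^ n * z powr (p - 1))"
      using L by (intro mult_left_mono) auto
    finally show ?thesis .
  next
    case False
    then have "(y - z) * r ^ n \<le> 0"
      using that by (intro mult_nonpos_nonneg) auto
    also have "0 \<le> L * max 0 (r ^ n * y powr (p - 1) - r ^ n * z powr (p - 1))"
      using L by simp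
    finally show ?thesis .
  qed
  show ?thesis
  proof (rule that[OF L])
    show "(Y r - Z r) * r ^ n \<le> L * max 0 (- \<Phi> r)" if "0 < r" "r \<le> R" for r
      using key[of r "Y r" "Z r"] M_bound[of r] u.Y(3)[of r] v.Y(3)[of r] that by (simp add: \<Phi>_def)
    show "(Z r - Y r) * r ^ n \<le> L * max 0 (\<Phi> r)" if "0 < r" "r \<le> R" for r
      using key[of r "Z r" "Y r"] M_bound[of r] v.Y(3)[of r] u.Y(3)[of r] that by (simp add: \<Phi>_def)
  qed
qed

section \<open>Propagation of zeros\<close>

text \<open>The weight \<open>r ^ n\<close> is nondecreasing in the direction of propagation, so it
  can serve as \<open>\<omega>\<close>, and the starting point \<open>a = 0\<close> is
  included.\<close>

lemma W_eq_0_right: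
  assumes a: "0 \<le> a" "a < R" and W: "W a = 0"
  obtains \<epsilon> where "0 < \<epsilon>" and "\<And>t. a \<le> t \<Longrightarrow> t \<le> a + \<epsilon> \<Longrightarrow> W t = 0"
proof -
  obtain C where C: "0 \<le> C"
    "\<And>r. 0 < r \<Longrightarrow> r < R \<Longrightarrow> - (C * r ^ n * (R - r) powr (- 1 - \<delta>) * W r) \<le> \<Phi>' r"
    using \<Phi>'_lower_bound by metis
  obtain L where L: "0 \<le> L"
    "\<And>r. 0 < r \<Longrightarrow> r \<le> R \<Longrightarrow> (Y r - Z r) * r ^ n \<le> L * max 0 (- \<Phi> r)"
    "\<And>r. 0 < r \<Longrightarrow> r \<le> R \<Longrightarrow> (Z r - Y r) * r ^ n \<le> L * max 0 (\<Phi> r)"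
    using flux_controls_slope by metis
  obtain M where M: "\<And>r. 0 \<le> r \<Longrightarrow> r \<le> R \<Longrightarrow> Y r \<le> M \<and> Z r \<le> M"
    using slope_bound by metis
  \<comment> \<open>Up to the midpoint \<open>t - a \<le> R - t\<close>, so the coefficient
    \<open>(R - t) powr (- 1 - \<delta>)\<close> is at most
    \<open>(t - a) powr (- 1 - \<delta>)\<close>. The interior case thus takes the form of the
    boundary case.\<close>
  define b where "b = (a + R) / 2"
  have b: "a < b" "b < R" "\<And>t. t \<le> b \<Longrightarrow> t - a \<le> R - t"
    using a by (auto simp: b_def field_simps)
  have sub: "{a..b} \<subseteq> {0..R}"
    using a b by auto
  show ?thesis
  proof (rule degenerate_uniqueness[where W = W and \<Phi> = \<Phi> and a = a and b = b and \<delta> = \<delta> and C = C and L = L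
        and \<omega> = "\<lambda>r. r ^ n" and \<omega>' = "\<lambda>r. n * r ^ (n - 1)" and W' = "\<lambda>r. Y r - Z r"
        and \<Phi>' = \<Phi>' and B = M])
    show "\<delta> < 1" "0 \<le> C" "0 \<le> L" "a < b" "W a = 0" "\<Phi> a = 0"
      using u.\<delta> C L b W \<Phi>_eq_0 a by auto
    show "continuous_on {a..b} W" "continuous_on {a..b} \<Phi>" "continuous_on {a..b} (\<lambda>r. r ^ n)"
      using continuous_on_subset[OF W_cont sub] continuous_on_subset[OF \<Phi>_cont sub]
      by (auto intro: continuous_intros)
    fix t
    show "0 \<le> W t" if "a \<le> t" "t \<le> b"
      using that a b by (intro W_nonneg) auto
    assume t: "a < t" "t < b"
    then have t': "0 < t" "t < R"
      using a b by auto
    show "(W has_real_derivative Y t - Z t) (at t)" "(\<Phi> has_real_derivative \<Phi>' t) (at t)"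
      using W_deriv \<Phi>_deriv t' by auto
    show "((\<lambda>r. r ^ n) has_real_derivative n * t ^ (n - 1)) (at t)"
      using DERIV_pow[of n t UNIV] by simp
    show "0 \<le> n * t ^ (n - 1)" "0 < t ^ n"
      using t' by auto
    show "(Y t - Z t) * t ^ n \<le> L * max 0 (- \<Phi> t)"
      using L(2) t' by simp
    show "Y t - Z t \<le> M"
      using M[of t] v.Y(3)[of t] t' by simp
    have "C * t ^ n * (R - t) powr (- 1 - \<delta>) * W t \<le> C * t ^ n * (t - a) powr (- 1 - \<delta>) * W t"
      using C(1) t t' b u.\<delta> W_nonneg[of t]
      by (intro mult_right_mono mult_left_mono powr_mono2') auto
    then show "- (C * t ^ n * (t - a) powr (- 1 - \<delta>) * W t) \<le> \<Phi>' t"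
      using C(2)[OF t'] by linarith
  qed (use that in blast)
qed

text \<open>Besides propagating interior zeros, the case \<open>a = R\<close> is Hopf's boundary lemma.\<close>

lemma W_eq_0_left:
  assumes a: "0 < a" "a \<le> R" and W: "W a = 0" and \<Phi>: "\<Phi> a = 0"
  obtains \<epsilon> where "0 < \<epsilon>" and "\<epsilon> < a" and "\<And>t. a - \<epsilon> \<le> t \<Longrightarrow> t \<le> a \<Longrightarrow> W t = 0"
proof -
  obtain C where C: "0 \<le> C"
    "\<And>r. 0 < r \<Longrightarrow> r < R \<Longrightarrow> - (C * r ^ n * (R - r) powr (- 1 - \<delta>) * W r) \<le> \<Phi>' r"
    using \<Phi>'_lower_bound by metis
  obtain L where L: "0 \<le> L"
    "\<And>r. 0 < r \<Longrightarrow> r \<le> R \<Longrightarrow> (Y r - Z r) * r ^ n \<le> L * max 0 (- \<Phi> r)"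
    "\<And>r. 0 < r \<Longrightarrow> r \<le> R \<Longrightarrow> (Z r - Y r) * r ^ n \<le> L * max 0 (\<Phi> r)"
    using flux_controls_slope by metis
  obtain M where M: "\<And>r. 0 \<le> r \<Longrightarrow> r \<le> R \<Longrightarrow> Y r \<le> M \<and> Z r \<le> M"
    using slope_bound by metis
  have refl: "continuous_on {0..a/2} (\<lambda>t. F (a - t))" if "continuous_on {0..R} F"
    for F :: "real \<Rightarrow> real"
    by (rule continuous_on_compose2[OF that]) (use a in \<open>auto intro!: continuous_intros\<close>)
  have refl_deriv: "((\<lambda>t. F (a - t)) has_real_derivative - D) (at t)"
    if "(F has_real_derivative D) (at (a - t))" for F :: "real \<Rightarrow> real" and D t
  proof -
    have "((\<lambda>t. a - t) has_real_derivative - 1) (at t)"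
      by (auto intro!: derivative_eq_intros)
    from DERIV_chain2[OF that this] show ?thesis
      by simp
  qed
  obtain \<epsilon> where \<epsilon>: "0 < \<epsilon>" "\<epsilon> \<le> a/2 - 0" "\<And>t. 0 \<le> t \<Longrightarrow> t \<le> 0 + \<epsilon> \<Longrightarrow> W (a - t) = 0"
  \<comment> \<open>Under \<open>t \<mapsto> a - t\<close> the weight \<open>(a - t) ^ n\<close> is
    no longer nondecreasing (unless \<open>n = 0\<close>), so \<open>\<omega> = 1\<close> is taken.
    On \<open>t < a/2\<close> the radius lies between \<open>a/2\<close> and \<open>R\<close>; its
    powers are absorbed into \<open>L\<close> and \<open>C\<close>. The flux difference changes sign
    under the reflection.\<close>
  proof (rule degenerate_uniqueness[where W = "\<lambda>t. W (a - t)" and \<Phi> = "\<lambda>t. - \<Phi> (a - t)"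
        and a = 0 and b = "a/2" and \<delta> = \<delta> and C = "C * R ^ n" and L = "L / (a/2) ^ n"
        and \<omega> = "\<lambda>r. 1" and \<omega>' = "\<lambda>r. 0" and W' = "\<lambda>t. Z (a - t) - Y (a - t)"
        and \<Phi>' = "\<lambda>t. \<Phi>' (a - t)" and B = M])
    show "\<delta> < 1" "0 \<le> C * R ^ n" "0 \<le> L / (a/2) ^ n" "0 < a/2" "W (a - 0) = 0" "- \<Phi> (a - 0) = 0"
      using u.\<delta> C L W \<Phi> a u.R by auto
    show "continuous_on {0..a/2} (\<lambda>t. W (a - t))" "continuous_on {0..a/2} (\<lambda>t. - \<Phi> (a - t))"
      "continuous_on {0..a/2} (\<lambda>t. 1 :: real)"
      by (intro continuous_intros refl W_cont \<Phi>_cont)+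
    fix t
    show "0 \<le> W (a - t)" if "0 \<le> t" "t \<le> a/2"
      using that a by (intro W_nonneg) auto
    assume t: "0 < t" "t < a/2"
    then have t': "0 < a - t" "a - t < R"
      using a by auto
    show "((\<lambda>t. W (a - t)) has_real_derivative Z (a - t) - Y (a - t)) (at t)"
      using refl_deriv[OF W_deriv[OF t']] by simp
    show "((\<lambda>t. - \<Phi> (a - t)) has_real_derivative \<Phi>' (a - t)) (at t)"
      using DERIV_minus[OF refl_deriv[OF \<Phi>_deriv[OF t']]] by simp
    show "((\<lambda>t. 1) has_real_derivative 0) (at t)" "0 \<le> (0 :: real)" "0 < (1 :: real)"
      by auto
    show "Z (a - t) - Y (a - t) \<le> M"
      using M[of "a - t"] u.Y(3)[of "a - t"] t' by simp
    have pow: "0 < (a/2) ^ n" "(a/2) ^ n \<le> (a - t) ^ n" "(a - t) ^ n \<le> R ^ n"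
      using a t t' by (auto intro!: power_mono)
    show "(Z (a - t) - Y (a - t)) * 1 \<le> L / (a/2) ^ n * max 0 (- (- \<Phi> (a - t)))"
    proof (cases "Z (a - t) \<le> Y (a - t)")
      case True
      then show ?thesis
        using L(1) pow(1) by (auto intro: order.trans[of _ 0])
    next
      case False
      then have "(Z (a - t) - Y (a - t)) * (a/2) ^ n \<le> (Z (a - t) - Y (a - t)) * (a - t) ^ n"
        using pow by (intro mult_left_mono) auto
      also have "\<dots> \<le> L * max 0 (\<Phi> (a - t))"
        using L(3) t' by simp
      finally show ?thesis
        using pow(1) by (simp add: pos_le_divide_eq)
    qed
    \<comment> \<open>Here \<open>R - (a - t) \<ge> t\<close> because \<open>a \<le> R\<close>, with
      equality at the boundary \<open>a = R\<close>.\<close>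
    have "C * (a - t) ^ n * (R - (a - t)) powr (- 1 - \<delta>) * W (a - t) \<le>
        C * R ^ n * t powr (- 1 - \<delta>) * W (a - t)"
      using C(1) t t' a u.\<delta> u.R pow W_nonneg[of "a - t"]
      by (intro mult_right_mono mult_mono mult_left_mono powr_mono2') auto
    then show "- (C * R ^ n * 1 * (t - 0) powr (- 1 - \<delta>) * W (a - t)) \<le> \<Phi>' (a - t)"
      using C(2)[OF t'] by simp
  qed blast
  show ?thesis
  proof (rule that[OF \<epsilon>(1)])
    show "\<epsilon> < a"
      using \<epsilon>(2) a by simp
    show "W t = 0" if "a - \<epsilon> \<le> t" "t \<le> a" for t
      using \<epsilon>(3)[of "a - t"] that by simp
  qed
qed

text \<open>Vanishing and non-vanishing of \<open>W\<close> are both relatively open in the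
  connected set \<open>{0..<R}\<close>: the first by propagation to both sides (only to the right at
  the centre), the second by continuity.\<close>

lemma W_eq_0_everywhere:
  assumes a: "a \<in> {0..<R}" "W a = 0" and b: "b \<in> {0..<R}"
  shows "W b = 0"
proof (rule connected_induction_simple[of "{0..<R}" a b "\<lambda>r. W r = 0", OF _ a(1) b a(2)])
  fix r assume r: "r \<in> {0..<R}"
  show "\<exists>T. openin (top_of_set {0..<R}) T \<and> r \<in> T \<and> (\<forall>x\<in>T. \<forall>y\<in>T. W x = 0 \<longrightarrow> W y = 0)"
  proof (cases "W r = 0")
    case True
    obtain \<epsilon>1 where \<epsilon>1: "0 < \<epsilon>1" "\<And>t. r \<le> t \<Longrightarrow> t \<le> r + \<epsilon>1 \<Longrightarrow> W t = 0"
      using W_eq_0_right[of r] r True by auto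
    obtain \<epsilon>2 where \<epsilon>2: "0 < \<epsilon>2" "\<And>t. 0 \<le> t \<Longrightarrow> r - \<epsilon>2 \<le> t \<Longrightarrow> t \<le> r \<Longrightarrow> W t = 0"
    proof (cases "r = 0")
      case True
      with \<open>W r = 0\<close> that[of 1] show ?thesis
        by (metis nle_le zero_less_one)
    next
      case False
      then show ?thesis
        using W_eq_0_left[of r] \<Phi>_eq_0[of r] r \<open>W r = 0\<close> that by (metis atLeastLessThan_iff less_eq_real_def)
    qed
    have "W t = 0" if "t \<in> {0..<R} \<inter> {r - \<epsilon>2<..<r + \<epsilon>1}" for t
      using \<epsilon>1(2)[of t] \<epsilon>2(2)[of t] that by (cases "t \<le> r") auto
    then show ?thesis
      using r \<epsilon>1(1) \<epsilon>2(1)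
      by (intro exI[of _ "{0..<R} \<inter> {r - \<epsilon>2<..<r + \<epsilon>1}"]) (auto intro: openin_open_Int)
  next
    case False
    have "openin (top_of_set {0..<R}) ({0..<R} \<inter> W -` (- {0}))"
      by (rule continuous_openin_preimage_gen[OF continuous_on_subset[OF W_cont]]) auto
    then show ?thesis
      using False r by (intro exI[of _ "{0..<R} \<inter> W -` (- {0})"]) auto
  qed
qed auto

section \<open>Strict comparison inside and at the boundary\<close>

lemma U_less_V:
  assumes neq: "\<exists>r\<in>{0..<R}. f r \<noteq> g r" and r: "0 \<le> r" "r < R"
  shows "U r < V r"
proof (rule ccontr)
  assume "\<not> U r < V r"
  then have "W r = 0"
    using W_nonneg[of r] r by (simp add: W_def)
  then have W0: "W t = 0" if "t \<in> {0..<R}" for t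
    using W_eq_0_everywhere[of r t] that r by simp
  have eq: "f t = g t" if t: "0 < t" "t < R" for t
  proof -
    have "(\<Phi> has_real_derivative 0) (at t)"
    proof (rule has_field_derivative_transform_within_open[OF DERIV_const, of "{0<..<R}"])
      show "0 = \<Phi> s" if "s \<in> {0<..<R}" for s
        using \<Phi>_eq_0[of s] W0[of s] that by simp
    qed (use t in auto)
    then have "\<Phi>' t = 0"
      using \<Phi>_deriv[OF t] DERIV_unique by blast
    moreover have "U t = V t"
      using W0[of t] t by (simp add: W_def)
    ultimately show ?thesis
      using t by (simp add: \<Phi>'_def)
  qed
  \<comment> \<open>The differentiated flux identity holds only for positive radii; the centre is
    reached by continuity of \<open>f\<close> and \<open>g\<close>.\<close>
  have "f 0 = g 0"
  proof (rule tendsto_unique)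
    show "at_right (0 :: real) \<noteq> bot" by simp
    have lim: "(F \<longlongrightarrow> F 0) (at_right 0)" if "continuous_on {0..<R} F" for F :: "real \<Rightarrow> real"
    proof (rule continuous_on_Icc_at_rightD)
      show "continuous_on {0..R/2} F"
        by (rule continuous_on_subset[OF that]) (use u.R in auto)
    qed (use u.R in simp)
    show "(g \<longlongrightarrow> g 0) (at_right 0)"
      using lim v.h(1) by simp
    have "eventually (\<lambda>t. f t = g t) (at_right 0)"
      using eventually_at_right_real[OF u.R] by eventually_elim (auto intro: eq)
    then show "(g \<longlongrightarrow> f 0) (at_right 0)"
      using lim[OF u.h(1)] by (rule Lim_transform_eventually[rotated])
  qed
  with eq neq show False
    by (metis atLeastLessThan_iff less_eq_real_def)
qed

text \<open>Since \<open>W \<ge> 0 = W R\<close>, the left derivative of \<open>W\<close> at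
  \<open>R\<close> is at most 0, which gives \<open>Y R \<le> Z R\<close>. Equality would mean
  \<open>\<Phi> R = 0\<close>, and propagation from \<open>R\<close> would then contradict
  \<open>U < V\<close> inside.\<close>

lemma Y_less_Z_boundary:
  assumes neq: "\<exists>r\<in>{0..<R}. f r \<noteq> g r"
  shows "Y R < Z R"
proof (rule ccontr)
  assume "\<not> Y R < Z R"
  have WR: "((\<lambda>r. W r) has_real_derivative Y R - Z R) (at_left R)"
    unfolding W_def using DERIV_diff[OF v.U_boundary_deriv u.U_boundary_deriv] by simp
  have "Y R \<le> Z R"
  proof (rule ccontr)
    assume "\<not> Y R \<le> Z R"
    then obtain d where d: "0 < d" "\<And>h. 0 < h \<Longrightarrow> R - h \<in> {..<R} \<Longrightarrow> h < d \<Longrightarrow> W (R - h) < W R"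
      using has_real_derivative_pos_inc_left[OF WR] by auto
    have "W (R - min d R / 2) < 0"
      using d(2)[of "min d R / 2"] d(1) u.R W_R by auto
    moreover have "0 \<le> W (R - min d R / 2)"
      using d(1) u.R by (intro W_nonneg) auto
    ultimately show False by simp
  qed
  with \<open>\<not> Y R < Z R\<close> have "\<Phi> R = 0"
    using \<Phi>_eq_0_iff[of R] u.R by simp
  then obtain \<epsilon> where "0 < \<epsilon>" "\<epsilon> < R" "W (R - \<epsilon>) = 0"
    using W_eq_0_left[of R] u.R W_R by (metis diff_le_eq le_add_same_cancel1 less_eq_real_def order_refl)
  then show False
    using U_less_V[OF neq, of "R - \<epsilon>"] by (simp add: W_def)
qed

end

section \<open>Radial weak solutions\<close>

lemma radial_test_function:
  fixes \<rho> :: "real \<Rightarrow> real"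
  assumes smooth: "\<And>k. C_k k \<rho>" and supp: "\<And>t. b\<^sup>2 \<le> t \<Longrightarrow> \<rho> t = 0" and b: "0 \<le> b" "b < R"
  shows "test_function (ball 0 R) (\<lambda>x :: 'a::euclidean_space. \<rho> (x \<bullet> x))"
  unfolding test_function_def
proof (intro conjI allI)
  let ?S = "closure {x :: 'a. \<rho> (x \<bullet> x) \<noteq> 0}"
  show "C_k k (\<lambda>x :: 'a. \<rho> (x \<bullet> x))" for k
    by (rule C_k_compose_inner_self[OF smooth])
  have "x \<in> cball 0 b" if "\<rho> (x \<bullet> x) \<noteq> 0" for x :: 'a
  proof (rule ccontr)
    assume "x \<notin> cball 0 b"
    then have "b\<^sup>2 \<le> x \<bullet> x"
      using b(1) by (simp add: power_mono flip: power2_norm_eq_inner)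
    with that supp show False by simp
  qed
  then have sub: "?S \<subseteq> cball 0 b"
    by (intro closure_minimal) auto
  then show "compact ?S"
    using bounded_subset bounded_cball by (auto simp: compact_eq_bounded_closed)
  show "?S \<subseteq> ball 0 R"
    using sub b(2) by auto
qed

lemma gradient_radial_test_function:
  fixes x :: "'a::euclidean_space"
  assumes "\<And>t. (\<rho> has_real_derivative \<rho>' t) (at t)"
  shows "gradient (\<lambda>x. \<rho> (x \<bullet> x)) x = (2 * \<rho>' (x \<bullet> x)) *\<^sub>R x"
proof (rule gradient_eqI)
  have "((\<lambda>x. x \<bullet> x) has_derivative (\<lambda>h. 2 * (x \<bullet> h))) (at x)"
    by (auto intro!: derivative_eq_intros simp: inner_commute)
  moreover have "(\<rho> has_derivative (\<lambda>h. \<rho>' (x \<bullet> x) * h)) (at (x \<bullet> x))"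
    using assms by (simp add: has_field_derivative_def)
  ultimately have "((\<lambda>x. \<rho> (x \<bullet> x)) has_derivative (\<lambda>h. \<rho>' (x \<bullet> x) * (2 * (x \<bullet> h)))) (at x)"
    by (rule has_derivative_compose)
  then show "GDERIV (\<lambda>x. \<rho> (x \<bullet> x)) x :> (2 * \<rho>' (x \<bullet> x)) *\<^sub>R x"
    unfolding gderiv_def by (simp add: inner_commute mult_ac)
qed

lemma p_flux_radial_inner:
  fixes x :: "'a::real_inner"
  assumes "x \<noteq> 0" and "0 \<le> y"
  shows "p_flux p ((- y / norm x) *\<^sub>R x) \<bullet> (c *\<^sub>R x) = - (y powr (p - 1) * norm x * c)"
proof (cases "y = 0")
  case False
  then have "y powr (p - 1) = y powr (p - 2) * y"
    using assms powr_add[of y "p - 2" 1] by simp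
  with assms show ?thesis
    by (simp add: p_flux_def power2_norm_eq_inner[symmetric] power2_eq_square)
qed (simp add: p_flux_def)

text \<open>
  The test function is \<open>\<rho>(|x|\<^sup>2)\<close> with \<open>\<rho>' = - bump\<close>; the square keeps it smooth at the origin.
  Integrating the right-hand side by parts leaves the bump as a free weight.
\<close>

lemma weak_solution_radial_identity:
  fixes f u :: "'a::euclidean_space \<Rightarrow> real" and U Y h :: "real \<Rightarrow> real"
  defines "n \<equiv> DIM('a) - 1"
  assumes p: "1 < p" and ab: "0 \<le> a" "a < b" "b < R"
    and weak: "weak_solution p l \<delta> (ball 0 R) f u"
    and u: "\<And>x. x \<in> ball 0 R \<Longrightarrow> u x = U (norm x)"
    and f: "\<And>x. x \<in> ball 0 R \<Longrightarrow> f x = h (norm x)"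
    and grad: "\<And>x. x \<in> ball 0 R \<Longrightarrow> x \<noteq> 0 \<Longrightarrow> gradient u x = (- Y (norm x) / norm x) *\<^sub>R x"
    and cont: "continuous_on {0..b} U" "continuous_on {0..b} Y" "continuous_on {0..b} h"
    and U: "\<And>r. 0 \<le> r \<Longrightarrow> r \<le> b \<Longrightarrow> 0 < U r"
    and Y: "\<And>r. 0 \<le> r \<Longrightarrow> r \<le> b \<Longrightarrow> 0 \<le> Y r"
  shows "integral {0..b} (\<lambda>r. (r ^ n * Y r powr (p - 1) -
      integral {0..r} (\<lambda>s. s ^ n * (l / U s powr \<delta> + h s))) * (2 * r * bump (a\<^sup>2) (b\<^sup>2) (r\<^sup>2))) = 0"
proof -
  let ?\<beta> = "bump (a\<^sup>2) (b\<^sup>2)" and ?B = "ball (0 :: 'a) R"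
  define H where "H s = s ^ n * (l / U s powr \<delta> + h s)" for s
  define F where "F r = integral {0..r} H" for r
  obtain \<rho> where \<rho>: "\<And>t. (\<rho> has_real_derivative - ?\<beta> t) (at t)"
    "\<And>t. b\<^sup>2 \<le> t \<Longrightarrow> \<rho> t = 0" "\<And>k. C_k k \<rho>"
    using bump_primitive by metis
  let ?\<phi> = "\<lambda>x :: 'a. \<rho> (x \<bullet> x)"
  have test: "test_function ?B ?\<phi>"
    using ab by (intro radial_test_function[OF \<rho>(3,2)]) auto
  have \<rho>_cont: "continuous_on S \<rho>" for S
    using \<rho>(1) by (meson DERIV_isCont continuous_at_imp_continuous_on)
  have H_cont: "continuous_on {0..b} H"
    unfolding H_def using U
    by (intro continuous_intros cont) (auto simp: less_le)
  have U_powr_cont: "continuous_on {0..b} (\<lambda>r. l / U r powr \<delta>)"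
    using U by (intro continuous_intros cont) (auto simp: less_le)
  have Y_powr_cont: "continuous_on {0..b} (\<lambda>r. Y r powr (p - 1))"
    using Y p by (intro continuous_on_powr' continuous_intros cont) auto
  have \<beta>_cont: "continuous_on S (\<lambda>r. ?\<beta> (r\<^sup>2))" and \<rho>2_cont: "continuous_on S (\<lambda>r. \<rho> (r\<^sup>2))" for S
    by (auto intro!: continuous_on_compose2[OF continuous_on_bump[of UNIV]]
        continuous_on_compose2[OF \<rho>_cont[of UNIV]] continuous_intros)
  define T1 where "T1 r = Y r powr (p - 1) * (2 * r * ?\<beta> (r\<^sup>2))" for r
  define T2 where "T2 r = l / U r powr \<delta> * \<rho> (r\<^sup>2)" for r
  define T3 where "T3 r = h r * \<rho> (r\<^sup>2)" for r
  have T_cont: "continuous_on {0..b} T1" "continuous_on {0..b} T2" "continuous_on {0..b} T3"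
    unfolding T1_def T2_def T3_def
    by (intro continuous_intros Y_powr_cont U_powr_cont \<beta>_cont \<rho>2_cont cont)+
  have norm2: "b\<^sup>2 \<le> x \<bullet> x" if "\<not> norm x \<le> b" for x :: 'a
    using that ab by (simp add: power_mono flip: power2_norm_eq_inner)
  have in_B: "x \<in> ?B" if "norm x \<le> b" for x
    using that ab by simp
  \<comment> \<open>The test function and its gradient vanish for \<open>norm x \<ge> b\<close>, so
    each integral over the ball becomes a radial integral over \<open>{0..b}\<close>, where the
    profiles are continuous.\<close>
  have E1: "(LINT x:?B|lborel. p_flux p (gradient u x) \<bullet> gradient ?\<phi> x) =
      (LINT x|lborel. indicator {0..b} (norm (x :: 'a)) * T1 (norm x))"
    unfolding set_lebesgue_integral_def
  proof (rule Bochner_Integration.integral_cong[OF refl])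
    fix x :: 'a
    have g: "gradient ?\<phi> x = (- 2 * ?\<beta> (x \<bullet> x)) *\<^sub>R x"
      using gradient_radial_test_function[of \<rho> "\<lambda>t. - ?\<beta> t", OF \<rho>(1)] by simp
    show "indicator ?B x *\<^sub>R (p_flux p (gradient u x) \<bullet> gradient ?\<phi> x) =
        indicator {0..b} (norm x) * T1 (norm x)"
    proof (cases "norm x \<le> b")
      case True
      show ?thesis
      \<comment> \<open>No formula for \<open>gradient u 0\<close> is assumed; the gradient of the
        test function vanishes at the origin, and so does \<open>T1 0\<close>.\<close>
      proof (cases "x = 0")
        case False
        then show ?thesis
          unfolding g T1_def grad[OF in_B[OF True] False]
          by (subst p_flux_radial_inner) (use True False Y[of "norm x"] in_B[of x] in
              \<open>auto simp: power2_norm_eq_inner\<close>)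
      qed (use g in \<open>simp add: T1_def\<close>)
    next
      case False
      then show ?thesis
        using norm2[OF False] by (simp add: g bump_eq_0)
    qed
  qed
  have E2: "(LINT x:?B|lborel. l / (u x powr \<delta>) * ?\<phi> x) =
      (LINT x|lborel. indicator {0..b} (norm (x :: 'a)) * T2 (norm x))"
    unfolding set_lebesgue_integral_def
  proof (rule Bochner_Integration.integral_cong[OF refl])
    fix x :: 'a
    show "indicator ?B x *\<^sub>R (l / (u x powr \<delta>) * ?\<phi> x) = indicator {0..b} (norm x) * T2 (norm x)"
      using norm2[of x] \<rho>(2) in_B[of x] u[of x]
      by (cases "norm x \<le> b") (auto simp: T2_def power2_norm_eq_inner)
  qed
  have E3: "(LINT x:?B|lborel. f x * ?\<phi> x) =
      (LINT x|lborel. indicator {0..b} (norm (x :: 'a)) * T3 (norm x))"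
    unfolding set_lebesgue_integral_def
  proof (rule Bochner_Integration.integral_cong[OF refl])
    fix x :: 'a
    show "indicator ?B x *\<^sub>R (f x * ?\<phi> x) = indicator {0..b} (norm x) * T3 (norm x)"
      using norm2[of x] \<rho>(2) in_B[of x] f[of x]
      by (cases "norm x \<le> b") (auto simp: T3_def power2_norm_eq_inner)
  qed
  \<comment> \<open>The area of the unit sphere, a positive factor common to the three
    integrals.\<close>
  define c where "c = unit_ball_vol DIM('a) * DIM('a)"
  have "0 < c"
    by (simp add: c_def)
  have "c * integral {0..b} (\<lambda>r. r ^ n * T1 r) - c * integral {0..b} (\<lambda>r. r ^ n * T2 r) =
      c * integral {0..b} (\<lambda>r. r ^ n * T3 r)"
    unfolding c_def n_def integral_radial[OF order.refl T_cont(1), symmetric, where 'a = 'a]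
      integral_radial[OF order.refl T_cont(2), symmetric, where 'a = 'a]
      integral_radial[OF order.refl T_cont(3), symmetric, where 'a = 'a] E1[symmetric] E2[symmetric] E3[symmetric]
    using weak test unfolding weak_solution_def by blast
  then have "c * (integral {0..b} (\<lambda>r. r ^ n * T1 r) -
      integral {0..b} (\<lambda>r. r ^ n * T2 r) - integral {0..b} (\<lambda>r. r ^ n * T3 r)) = 0"
    by (simp add: right_diff_distrib)
  then have I: "integral {0..b} (\<lambda>r. r ^ n * T1 r) =
      integral {0..b} (\<lambda>r. r ^ n * T2 r) + integral {0..b} (\<lambda>r. r ^ n * T3 r)"
    using \<open>0 < c\<close> by simp
  have int: "(\<lambda>r. r ^ n * T1 r) integrable_on {0..b}" "(\<lambda>r. r ^ n * T2 r) integrable_on {0..b}"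
    "(\<lambda>r. r ^ n * T3 r) integrable_on {0..b}"
    by (intro integrable_continuous_interval continuous_intros T_cont)+
  have F_deriv: "(F has_real_derivative H r) (at r within {0..b})" if "r \<in> {0..b}" for r
    unfolding F_def by (rule integral_has_real_derivative[OF H_cont that])
  have F_cont: "continuous_on {0..b} F"
    by (rule DERIV_continuous_on[OF F_deriv])
  \<comment> \<open>Integration by parts through the derivative of
    \<open>F r * \<rho> (r\<^sup>2)\<close>; the boundary terms vanish because
    \<open>\<rho> (b\<^sup>2) = 0\<close> and \<open>F 0 = 0\<close>.\<close>
  have "((\<lambda>r. H r * \<rho> (r\<^sup>2) - F r * (2 * r * ?\<beta> (r\<^sup>2))) has_integral
      F b * \<rho> (b\<^sup>2) - F 0 * \<rho> (0\<^sup>2)) {0..b}"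
  proof (rule fundamental_theorem_of_calculus)
    fix r assume r: "r \<in> {0..b}"
    have "((\<lambda>r. \<rho> (r\<^sup>2)) has_real_derivative - ?\<beta> (r\<^sup>2) * (2 * r)) (at r within {0..b})"
      by (rule DERIV_chain2[OF \<rho>(1)]) (auto intro!: derivative_eq_intros)
    from DERIV_mult[OF F_deriv[OF r] this]
    have "((\<lambda>r. F r * \<rho> (r\<^sup>2)) has_real_derivative H r * \<rho> (r\<^sup>2) - F r * (2 * r * ?\<beta> (r\<^sup>2)))
        (at r within {0..b})"
      by (simp add: algebra_simps)
    then show "((\<lambda>r. F r * \<rho> (r\<^sup>2)) has_vector_derivative H r * \<rho> (r\<^sup>2) - F r * (2 * r * ?\<beta> (r\<^sup>2)))
        (at r within {0..b})"
      by (simp add: has_real_derivative_iff_has_vector_derivative)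
  qed (use ab in simp)
  from integral_unique[OF this]
  have "integral {0..b} (\<lambda>r. H r * \<rho> (r\<^sup>2) - F r * (2 * r * ?\<beta> (r\<^sup>2))) =
      F b * \<rho> (b\<^sup>2) - F 0 * \<rho> (0\<^sup>2)" .
  also have "\<dots> = 0"
    using \<rho>(2)[of "b\<^sup>2"] by (simp add: F_def)
  finally have "integral {0..b} (\<lambda>r. H r * \<rho> (r\<^sup>2) - F r * (2 * r * ?\<beta> (r\<^sup>2))) = 0" .
  moreover have "(\<lambda>r. H r * \<rho> (r\<^sup>2)) integrable_on {0..b}"
    "(\<lambda>r. F r * (2 * r * ?\<beta> (r\<^sup>2))) integrable_on {0..b}"
    by (intro integrable_continuous_interval continuous_intros H_cont F_cont \<beta>_cont \<rho>2_cont)+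
  ultimately have "integral {0..b} (\<lambda>r. F r * (2 * r * ?\<beta> (r\<^sup>2))) = integral {0..b} (\<lambda>r. H r * \<rho> (r\<^sup>2))"
    by (simp add: Henstock_Kurzweil_Integration.integral_diff)
  also have "(\<lambda>r. H r * \<rho> (r\<^sup>2)) = (\<lambda>r. r ^ n * T2 r + r ^ n * T3 r)"
    by (simp add: H_def T2_def T3_def algebra_simps)
  also have "integral {0..b} \<dots> = integral {0..b} (\<lambda>r. r ^ n * T1 r)"
    using I int by (simp add: Henstock_Kurzweil_Integration.integral_add)
  finally have "integral {0..b} (\<lambda>r. r ^ n * T1 r - F r * (2 * r * ?\<beta> (r\<^sup>2))) = 0"
    using int(1) \<open>(\<lambda>r. F r * (2 * r * ?\<beta> (r\<^sup>2))) integrable_on {0..b}\<close>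
    by (simp add: Henstock_Kurzweil_Integration.integral_diff)
  also have "(\<lambda>r. r ^ n * T1 r - F r * (2 * r * ?\<beta> (r\<^sup>2))) =
      (\<lambda>r. (r ^ n * Y r powr (p - 1) - F r) * (2 * r * ?\<beta> (r\<^sup>2)))"
    by (simp add: T1_def algebra_simps)
  finally show ?thesis
    unfolding F_def H_def .
qed

text \<open>The fundamental lemma of the calculus of variations: a nonzero defect at
  \<open>r0\<close> keeps its sign nearby, and a bump supported there would give a nonzero integral.
  Multiplying by \<open>d r0\<close> treats both signs at once.\<close>

lemma weak_solution_radial_flux:
  fixes f u :: "'a::euclidean_space \<Rightarrow> real" and U Y h :: "real \<Rightarrow> real"
  defines "n \<equiv> DIM('a) - 1"
  assumes p: "1 < p" and r0: "0 < r0" "r0 < R"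
    and weak: "weak_solution p l \<delta> (ball 0 R) f u"
    and u: "\<And>x. x \<in> ball 0 R \<Longrightarrow> u x = U (norm x)"
    and f: "\<And>x. x \<in> ball 0 R \<Longrightarrow> f x = h (norm x)"
    and grad: "\<And>x. x \<in> ball 0 R \<Longrightarrow> x \<noteq> 0 \<Longrightarrow> gradient u x = (- Y (norm x) / norm x) *\<^sub>R x"
    and cont: "continuous_on {0..<R} U" "continuous_on {0..<R} Y" "continuous_on {0..<R} h"
    and U: "\<And>r. 0 \<le> r \<Longrightarrow> r < R \<Longrightarrow> 0 < U r"
    and Y: "\<And>r. 0 \<le> r \<Longrightarrow> r < R \<Longrightarrow> 0 \<le> Y r"
  shows "r0 ^ n * Y r0 powr (p - 1) = integral {0..r0} (\<lambda>s. s ^ n * (l / U s powr \<delta> + h s))"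
proof (rule ccontr)
  define d where "d r = r ^ n * Y r powr (p - 1) -
    integral {0..r} (\<lambda>s. s ^ n * (l / U s powr \<delta> + h s))" for r
  assume "\<not> ?thesis"
  then have "d r0 \<noteq> 0"
    by (simp add: d_def)
  have d_cont: "continuous_on {0..b} d" if b: "b < R" for b
  proof -
    have sub: "{0..b} \<subseteq> {0..<R}"
      using b by auto
    note cont' = cont[THEN continuous_on_subset[OF _ sub]]
    have "continuous_on {0..b} (\<lambda>s. s ^ n * (l / U s powr \<delta> + h s))"
      using U b by (intro continuous_intros cont') (auto simp: less_le)
    then have "continuous_on {0..b} (\<lambda>r. integral {0..r} (\<lambda>s. s ^ n * (l / U s powr \<delta> + h s)))"
      by (intro indefinite_integral_continuous_1 integrable_continuous_interval)
    then show ?thesis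
      unfolding d_def using Y p b
      by (intro continuous_on_powr' continuous_intros cont') auto
  qed
  have "continuous (at r0) d"
    using continuous_on_interior[OF d_cont[of "(r0 + R) / 2"], of r0] r0 by simp
  then have "(d \<longlongrightarrow> d r0) (at r0)"
    by (simp add: isCont_def)
  then have "eventually (\<lambda>r. 0 < d r * d r0) (at r0)"
    using \<open>d r0 \<noteq> 0\<close> by (intro order_tendstoD[of _ "d r0 * d r0"] tendsto_intros)
      (auto simp: zero_less_mult_iff)
  then obtain e where e: "0 < e" "\<And>r. r \<noteq> r0 \<Longrightarrow> \<bar>r - r0\<bar> < e \<Longrightarrow> 0 < d r * d r0"
    unfolding eventually_at dist_real_def by auto
  \<comment> \<open>Halving \<open>e\<close> keeps the closed interval inside the neighbourhood of
    constant sign; the other two bounds keep it inside \<open>{0..<R}\<close>.\<close>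
  define a b where "a = max 0 (r0 - e / 2)" and "b = min (r0 + e / 2) ((r0 + R) / 2)"
  have ab: "0 \<le> a" "a < r0" "r0 < b" "b < R" "r0 - e < a" "b < r0 + e"
    using e(1) r0 by (auto simp: a_def b_def min_less_iff_disj)
  have d_sign: "0 \<le> d r * d r0" if "a \<le> r" "r \<le> b" for r
  proof (cases "r = r0")
    case False
    have "\<bar>r - r0\<bar> < e"
      using that ab by (simp add: abs_if)
    with e(2)[OF False] show ?thesis
      by simp
  qed simp
  let ?k = "\<lambda>r. d r * (2 * r * bump (a\<^sup>2) (b\<^sup>2) (r\<^sup>2))"
  have bump_cont: "continuous_on S (\<lambda>r. bump (a\<^sup>2) (b\<^sup>2) (r\<^sup>2))" for S
    by (rule continuous_on_compose2[OF continuous_on_bump[of UNIV]]) (auto intro!: continuous_intros)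
  have k_cont: "continuous_on {0..b} ?k"
    by (intro continuous_intros d_cont ab bump_cont)
  have sub: "{0..b} \<subseteq> {0..<R}"
    using ab by auto
  have "integral {0..b} ?k = 0"
    unfolding d_def n_def using ab U Y
    by (intro weak_solution_radial_identity[OF p _ _ _ weak u f grad])
      (auto intro: continuous_on_subset[OF cont(1) sub] continuous_on_subset[OF cont(2) sub]
        continuous_on_subset[OF cont(3) sub])
  then have "integral {0..b} (\<lambda>r. ?k r * d r0) = 0"
    by simp
  moreover have "0 \<le> ?k r * d r0" if r: "r \<in> {0..b}" for r
  proof (cases "a \<le> r")
    case True
    have "0 \<le> 2 * r * bump (a\<^sup>2) (b\<^sup>2) (r\<^sup>2)"
      using r bump_nonneg by simp
    from mult_nonneg_nonneg[OF d_sign[of r] this] True r show ?thesis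
      by (simp add: mult_ac)
  next
    case False
    then have "r\<^sup>2 \<le> a\<^sup>2"
      using r by (intro power_mono) auto
    then show ?thesis
      by (simp add: bump_eq_0)
  qed
  moreover have "continuous_on {0..b} (\<lambda>r. ?k r * d r0)"
    by (intro continuous_intros k_cont)
  ultimately have "?k r0 * d r0 = 0"
    using integral_eq_0_iff[of 0 b "\<lambda>r. ?k r * d r0"] ab by auto
  moreover have "0 < bump (a\<^sup>2) (b\<^sup>2) (r0\<^sup>2)"
    using ab r0 by (intro bump_pos power_strict_mono) auto
  ultimately show False
    using \<open>d r0 \<noteq> 0\<close> r0 by simp
qed

section \<open>From radial solutions on the ball to profiles\<close>

text \<open>Supplies continuity of the extended gradient on the closed ball, hence of
  \<open>Y\<close> up to \<open>R\<close>.\<close>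

lemma holder_on_imp_continuous_on:
  assumes "0 < \<alpha>" and "holder_on \<alpha> S G"
  shows "continuous_on S G"
proof -
  obtain C where C: "\<And>x y. x \<in> S \<Longrightarrow> y \<in> S \<Longrightarrow> dist (G x) (G y) \<le> C * dist x y powr \<alpha>"
    using assms(2) unfolding holder_on_def by blast
  show ?thesis
    unfolding continuous_on_def
  proof
    fix x assume x: "x \<in> S"
    have "((\<lambda>y. dist y x) \<longlongrightarrow> 0) (at x within S)"
      by (auto intro!: tendsto_eq_intros)
    then have "((\<lambda>y. C * dist y x powr \<alpha>) \<longlongrightarrow> C * 0) (at x within S)"
      using assms(1) by (intro tendsto_mult_left tendsto_zero_powrI[OF _ tendsto_const]) auto
    then have lim: "((\<lambda>y. C * dist y x powr \<alpha>) \<longlongrightarrow> 0) (at x within S)"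
      by simp
    have "((\<lambda>y. dist (G y) (G x)) \<longlongrightarrow> 0) (at x within S)"
    proof (rule tendsto_sandwich[OF _ _ tendsto_const lim])
      show "eventually (\<lambda>y. dist (G y) (G x) \<le> C * dist y x powr \<alpha>) (at x within S)"
        using C[OF _ x] by (simp add: eventually_at_filter)
    qed simp
    then show "(G \<longlongrightarrow> G x) (at x within S)"
      by (rule tendsto_dist_iff[THEN iffD2])
  qed
qed

lemma weak_solution_radial_profile:
  fixes f u :: "'a::euclidean_space \<Rightarrow> real"
  assumes params: "1 < p" "p \<le> 2" "0 < l" "0 < \<delta>" "\<delta> < 1" "0 < R" "0 < \<alpha>"
    and f: "continuous_on (ball 0 R) f" "radial_on (ball 0 R) f" "\<And>x. x \<in> ball 0 R \<Longrightarrow> 0 \<le> f x"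
    and C1: "C1_holder_closure \<alpha> (ball 0 R) u"
    and decr: "radially_decreasing_on (ball 0 R) u"
    and weak: "weak_solution p l \<delta> (ball 0 R) f u"
    and e: "norm e = 1"
  obtains Y where "radial_profile p l \<delta> R (DIM('a) - 1) (\<lambda>r. f (r *\<^sub>R e)) (\<lambda>r. u (r *\<^sub>R e)) Y"
proof -
  define U h where "U r = u (r *\<^sub>R e)" and "h r = f (r *\<^sub>R e)" for r
  have B: "r *\<^sub>R e \<in> ball 0 R \<longleftrightarrow> \<bar>r\<bar> < R" "r *\<^sub>R e \<in> closure (ball 0 R) \<longleftrightarrow> \<bar>r\<bar> \<le> R" for r
    using e \<open>0 < R\<close> by (auto simp: closure_ball)
  have u_cont: "continuous_on (closure (ball 0 R)) u"
    using C1 by (simp add: C1_holder_closure_def)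
  obtain G where G: "\<And>x. x \<in> ball 0 R \<Longrightarrow> GDERIV u x :> G x" "holder_on \<alpha> (closure (ball 0 R)) G"
    using C1 unfolding C1_holder_closure_def by blast
  have G_cont: "continuous_on (closure (ball 0 R)) G"
    using holder_on_imp_continuous_on[OF \<open>0 < \<alpha>\<close> G(2)] .
  \<comment> \<open>Taken from the extension \<open>G\<close> and not from
    \<open>gradient u\<close>, so that \<open>Y R\<close> is the limit of the inner slopes.\<close>
  define Y where "Y r = - (G (r *\<^sub>R e) \<bullet> e)" for r
  have u_eq: "u x = U (norm x)" and f_eq: "f x = h (norm x)" if "x \<in> ball 0 R" for x
  proof -
    have "norm (norm x *\<^sub>R e) = norm x" "norm x *\<^sub>R e \<in> ball 0 R"
      using e that by auto
    then show "u x = U (norm x)" "f x = h (norm x)"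
      using decr f(2) that unfolding radially_decreasing_on_def radial_on_def U_def h_def by metis+
  qed
  have U_deriv: "(U has_real_derivative - Y r) (at r)" if "\<bar>r\<bar> < R" for r
  proof -
    have "((\<lambda>r. r *\<^sub>R e) has_derivative (\<lambda>h. h *\<^sub>R e)) (at r)"
      by (auto intro!: derivative_eq_intros)
    moreover have "(u has_derivative (\<lambda>h. h \<bullet> G (r *\<^sub>R e))) (at (r *\<^sub>R e))"
      using G(1)[of "r *\<^sub>R e"] B that by (simp add: gderiv_def)
    ultimately have "((\<lambda>r. u (r *\<^sub>R e)) has_derivative (\<lambda>h. (h *\<^sub>R e) \<bullet> G (r *\<^sub>R e))) (at r)"
      by (rule has_derivative_compose)
    then show ?thesis
      by (simp add: has_field_derivative_def U_def Y_def inner_commute mult.commute[of _ "_ \<bullet> _"] flip: U_def)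
  qed
  have U_cont: "continuous_on {0..R} U" and Y_cont: "continuous_on {0..R} Y"
    unfolding U_def Y_def
    by (auto intro!: continuous_intros continuous_on_compose2[OF u_cont]
        continuous_on_compose2[OF G_cont] simp: B)
  have h_cont: "continuous_on {0..<R} h"
    unfolding h_def by (auto intro!: continuous_intros continuous_on_compose2[OF f(1)] simp: e)
  have U_pos: "0 < U r" if "0 \<le> r" "r < R" for r
    using weak B(1)[of r] that by (auto simp: weak_solution_def U_def simp del: mem_ball)
  have U_R: "U R = 0"
    using weak e \<open>0 < R\<close> by (auto simp: weak_solution_def U_def)
  have U_decr: "U s \<le> U r" if "\<bar>r\<bar> \<le> \<bar>s\<bar>" "\<bar>s\<bar> < R" for r s
    using decr B(1)[of r] B(1)[of s] that e
    by (auto simp: radially_decreasing_on_def U_def simp del: mem_ball)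
  \<comment> \<open>\<open>U\<close> is differentiable along the whole diameter, negative parameters
    included, and 0 is an interior maximum.\<close>
  have Y_0: "Y 0 = 0"
    using DERIV_local_max[OF U_deriv[of 0] \<open>0 < R\<close>] U_decr[of 0] \<open>0 < R\<close> by auto
  have Y_nonneg': "0 \<le> Y r" if "0 < r" "r < R" for r
  proof (rule ccontr)
    have "\<bar>r\<bar> < R"
      using that by simp
    moreover assume "\<not> 0 \<le> Y r"
    ultimately obtain d where d: "0 < d" "\<And>h. 0 < h \<Longrightarrow> h < d \<Longrightarrow> U r < U (r + h)"
      using DERIV_pos_inc_right[OF U_deriv[of r]] by auto
    have "U r < U (r + min d (R - r) / 2)"
      using d that by (intro d(2)) auto
    moreover have "U (r + min d (R - r) / 2) \<le> U r"
      using d(1) that by (intro U_decr) (auto simp: min_def field_simps)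
    ultimately show False by simp
  qed
  have Y_nonneg: "0 \<le> Y r" if "0 \<le> r" "r \<le> R" for r
    by (rule continuous_ge_on_closure[of "{0<..<R}" Y r 0])
      (use Y_cont that \<open>0 < R\<close> Y_nonneg' in auto)
  have grad: "gradient u x = (- Y (norm x) / norm x) *\<^sub>R x" if x: "x \<in> ball 0 R" "x \<noteq> 0" for x
  proof (rule gradient_eqI)
    have "(norm has_derivative (\<lambda>h. sgn x \<bullet> h)) (at x)"
      using has_derivative_norm[OF x(2)] by (simp add: inner_commute)
    moreover have "(U has_real_derivative - Y (norm x)) (at (norm x))"
      using U_deriv x by simp
    then have "(U has_derivative (\<lambda>h. - Y (norm x) * h)) (at (norm x))"
      unfolding has_field_derivative_def .
    ultimately have "((\<lambda>x. U (norm x)) has_derivative (\<lambda>h. - Y (norm x) * (sgn x \<bullet> h))) (at x)"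
      by (rule has_derivative_compose)
    then have "(u has_derivative (\<lambda>h. - Y (norm x) * (sgn x \<bullet> h))) (at x)"
      by (rule has_derivative_transform_within_open[of _ _ _ _ "ball 0 R"]) (use x u_eq in auto)
    then show "GDERIV u x :> (- Y (norm x) / norm x) *\<^sub>R x"
      by (simp add: gderiv_def sgn_div_norm inner_commute divide_inverse mult_ac)
  qed
  let ?n = "DIM('a) - 1"
  define H where "H s = s ^ ?n * (l / U s powr \<delta> + h s)" for s
  have flux_eq: "r ^ ?n * Y r powr (p - 1) = integral {0..r} H" if "0 < r" "r < R" for r
    unfolding H_def using U_cont Y_cont h_cont U_pos Y_nonneg
    by (intro weak_solution_radial_flux[OF params(1) that weak u_eq f_eq grad])
      (auto intro: continuous_on_subset)
  \<comment> \<open>The flux coincides on the open interval with an integral of the continuous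
    function \<open>H\<close>; this yields its differentiability although \<open>Y\<close> is only
    known to be continuous.\<close>
  have flux_deriv: "((\<lambda>r. r ^ ?n * Y r powr (p - 1)) has_real_derivative H r) (at r)"
    if r: "0 < r" "r < R" for r
  proof -
    define c where "c = (r + R) / 2"
    have c: "r < c" "c < R"
      using r by (auto simp: c_def)
    have sub: "{0..c} \<subseteq> {0..R}" "{0..c} \<subseteq> {0..<R}"
      using c by auto
    have "continuous_on {0..c} H"
      unfolding H_def using U_pos c
      by (intro continuous_intros continuous_on_subset[OF U_cont sub(1)]
          continuous_on_subset[OF h_cont sub(2)]) (auto simp: less_le)
    then have "((\<lambda>r. integral {0..r} H) has_real_derivative H r) (at r within {0..c})"
      using r c by (intro integral_has_real_derivative) auto
    then have "((\<lambda>r. integral {0..r} H) has_real_derivative H r) (at r)"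
      using at_within_Icc_at[of 0 r c] r c by simp
    then show ?thesis
      by (rule has_field_derivative_transform_within_open[of _ _ _ "{0<..<R}"]) (use r flux_eq in auto)
  qed
  have h_nonneg: "0 \<le> h r" if "0 \<le> r" "r < R" for r
    using f(3)[of "r *\<^sub>R e"] that e by (simp add: h_def)
  have "radial_profile p l \<delta> R ?n h U Y"
    using params h_cont h_nonneg U_cont Y_cont U_pos U_R Y_0 Y_nonneg U_deriv flux_deriv
    by unfold_locales (auto simp: H_def)
  moreover have "U = (\<lambda>r. u (r *\<^sub>R e))" "h = (\<lambda>r. f (r *\<^sub>R e))"
    by (auto simp: U_def h_def)
  ultimately show ?thesis
    using that by simp
qed

lemma radial_boundary_deriv_imp_normal:
  fixes u :: "'a::real_normed_vector \<Rightarrow> real"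
  assumes "((\<lambda>r. u (r *\<^sub>R \<nu>)) has_real_derivative d) (at_left R)"
  shows "has_normal_derivative u \<nu> (R *\<^sub>R \<nu>) d"
proof -
  have "((\<lambda>t. R + t) has_real_derivative 1) (at_left 0)"
    by (auto intro!: derivative_eq_intros)
  moreover have "(\<lambda>t. R + t) ` {..<0} \<subseteq> {..<R}"
    by auto
  then have "((\<lambda>r. u (r *\<^sub>R \<nu>)) has_real_derivative d) (at (R + 0) within (\<lambda>t. R + t) ` {..<0})"
    using has_field_derivative_subset[OF assms] by simp
  ultimately have "((\<lambda>r. u (r *\<^sub>R \<nu>)) \<circ> (\<lambda>t. R + t) has_real_derivative d * 1) (at_left 0)"
    by (rule DERIV_image_chain[rotated])
  then show ?thesis
    by (simp add: has_normal_derivative_def o_def scaleR_add_left)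
qed

theorem theorem1p1:
  fixes p l \<delta> R \<alpha> :: real
    and f g u v :: "'a::euclidean_space \<Rightarrow> real"
  assumes "1 < p" and "p \<le> 2"
    and "0 < l"
    and "0 < \<delta>" and "\<delta> < 1"
    and "0 < R"
    and "continuous_on (ball 0 R) f" and "radial_on (ball 0 R) f"
    and "continuous_on (ball 0 R) g" and "radial_on (ball 0 R) g"
    and "\<forall>x\<in>ball 0 R. 0 \<le> f x \<and> f x \<le> g x"
    and "\<exists>x\<in>ball 0 R. f x \<noteq> g x"
    and "0 < \<alpha>" and "\<alpha> < 1"
    and "C1_holder_closure \<alpha> (ball 0 R) u" and "C1_holder_closure \<alpha> (ball 0 R) v"
    and "radially_decreasing_on (ball 0 R) u" and "radially_decreasing_on (ball 0 R) v"
    and "weak_solution p l \<delta> (ball 0 R) f u"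
    and "weak_solution p l \<delta> (ball 0 R) g v"
  shows "(\<forall>x\<in>ball 0 R. 0 < u x \<and> u x < v x) \<and>
    (\<forall>x\<in>sphere 0 R. \<exists>du dv.
       has_normal_derivative u (x /\<^sub>R R) x du \<and>
       has_normal_derivative v (x /\<^sub>R R) x dv \<and>
       dv < du \<and> du < 0)"
proof -
  let ?n = "DIM('a) - 1"
  have pair: "\<exists>Y Z. profile_pair p l \<delta> R ?n (\<lambda>r. f (r *\<^sub>R e)) (\<lambda>r. u (r *\<^sub>R e)) Y
      (\<lambda>r. g (r *\<^sub>R e)) (\<lambda>r. v (r *\<^sub>R e)) Z" if e: "norm e = 1" for e :: 'a
  proof -
    obtain Y where Y: "radial_profile p l \<delta> R ?n (\<lambda>r. f (r *\<^sub>R e)) (\<lambda>r. u (r *\<^sub>R e)) Y"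
      by (rule weak_solution_radial_profile[of p l \<delta> R \<alpha> f u e]) (use assms e in auto)
    obtain Z where Z: "radial_profile p l \<delta> R ?n (\<lambda>r. g (r *\<^sub>R e)) (\<lambda>r. v (r *\<^sub>R e)) Z"
      by (rule weak_solution_radial_profile[of p l \<delta> R \<alpha> g v e]) (use assms e in \<open>auto intro: order.trans\<close>)
    have "f (r *\<^sub>R e) \<le> g (r *\<^sub>R e)" if "0 \<le> r" "r < R" for r
      using assms(11) e that by simp
    with Y Z show ?thesis
      by (intro exI profile_pair.intro profile_pair_axioms.intro) auto
  qed
  \<comment> \<open>Radiality moves a point where \<open>f\<close> and \<open>g\<close> differ to
    the same radius on the ray through \<open>e\<close>.\<close>
  have neq: "\<exists>r\<in>{0..<R}. f (r *\<^sub>R e) \<noteq> g (r *\<^sub>R e)" if e: "norm e = 1" for e :: 'a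
  proof -
    obtain x where x: "x \<in> ball 0 R" "f x \<noteq> g x"
      using assms(12) by blast
    have "norm x *\<^sub>R e \<in> ball 0 R" "norm (norm x *\<^sub>R e) = norm x"
      using e x by auto
    then have "f (norm x *\<^sub>R e) = f x" "g (norm x *\<^sub>R e) = g x"
      using assms(8,10) x(1) unfolding radial_on_def by blast+
    with x show ?thesis
      by (intro bexI[of _ "norm x"]) auto
  qed
  have "0 < u x \<and> u x < v x" if x: "x \<in> ball 0 R" for x
  proof
    show "0 < u x"
      using assms(19) x by (simp add: weak_solution_def)
    obtain e :: 'a where e: "norm e = 1" "x = norm x *\<^sub>R e"
    proof (cases "x = 0")
      case True
      obtain b :: 'a where "b \<in> Basis"
        using nonempty_Basis by blast
      with True that[of b] show ?thesis
        by simp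
    next
      case False
      with that[of "sgn x"] show ?thesis
        by (simp add: norm_sgn sgn_div_norm)
    qed
    obtain Y Z where "profile_pair p l \<delta> R ?n (\<lambda>r. f (r *\<^sub>R e)) (\<lambda>r. u (r *\<^sub>R e)) Y
      (\<lambda>r. g (r *\<^sub>R e)) (\<lambda>r. v (r *\<^sub>R e)) Z"
      using pair[OF e(1)] by blast
    then have "u (norm x *\<^sub>R e) < v (norm x *\<^sub>R e)"
      by (rule profile_pair.U_less_V[OF _ neq[OF e(1)]]) (use x in auto)
    with e(2) show "u x < v x"
      by simp
  qed
  moreover have "\<exists>du dv. has_normal_derivative u (x /\<^sub>R R) x du \<and>
      has_normal_derivative v (x /\<^sub>R R) x dv \<and> dv < du \<and> du < 0" if x: "x \<in> sphere 0 R" for x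
  proof -
    \<comment> \<open>The outward unit normal at \<open>x\<close> is \<open>x / R\<close>, so the
      normal derivatives are the left derivatives of the profiles along this ray at
      \<open>R\<close>, namely \<open>- Y R\<close> and \<open>- Z R\<close>.\<close>
    have e: "norm (x /\<^sub>R R) = 1" and x_eq: "R *\<^sub>R (x /\<^sub>R R) = x"
      using x \<open>0 < R\<close> by auto
    obtain Y Z where "profile_pair p l \<delta> R ?n (\<lambda>r. f (r *\<^sub>R (x /\<^sub>R R))) (\<lambda>r. u (r *\<^sub>R (x /\<^sub>R R))) Y
      (\<lambda>r. g (r *\<^sub>R (x /\<^sub>R R))) (\<lambda>r. v (r *\<^sub>R (x /\<^sub>R R))) Z"
      using pair[OF e] by blast
    then interpret profile_pair p l \<delta> R ?n "\<lambda>r. f (r *\<^sub>R (x /\<^sub>R R))" "\<lambda>r. u (r *\<^sub>R (x /\<^sub>R R))" Y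
      "\<lambda>r. g (r *\<^sub>R (x /\<^sub>R R))" "\<lambda>r. v (r *\<^sub>R (x /\<^sub>R R))" Z .
    have "has_normal_derivative u (x /\<^sub>R R) x (- Y R)" "has_normal_derivative v (x /\<^sub>R R) x (- Z R)"
      using radial_boundary_deriv_imp_normal[OF u.U_boundary_deriv]
        radial_boundary_deriv_imp_normal[OF v.U_boundary_deriv] unfolding x_eq .
    moreover have "- Z R < - Y R" "- Y R < 0"
      using Y_less_Z_boundary[OF neq[OF e]] u.Y_pos[of R] \<open>0 < R\<close> by auto
    ultimately show ?thesis
      by blast
  qed
  ultimately show ?thesis
    by blast
qed

end
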